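(* Let $T$ be a path on $n$ vertices with a rooted labeling. Then $S/I_T$ is a complete intersection if and only if the root of $T$ is either a leaf or the neighbor of a leaf.
   Context: All graphs are finite and simple. Let $\mathbb{K}$ be a field, $[n]=\{1,\ldots,n\}$ and $S=\mathbb{K}[x_1,\ldots,x_{n+1}]$. For $1\le i<j\le n$ put $g_{ij}=x_ix_{j+1}-x_jx_{i+1}$. For a graph $G$ with vertex set $[n]$, the Hankel edge ideal $I_G\subset S$ is the ideal generated by the $g_{ij}$ with $i<j$ and $\{i,j\}\in E(G)$. A rooted labeling of a tree $T$ with $n$ vertices is a labeling of its vertices by $1,\ldots,n$ obtained as follows (breadth-first). Choose any vertex as the root and give it the label $1$. Then process the labeled vertices $1,2,3,\ldots$ in increasing order of label; when vertex $i$ is processed, its not-yet-labeled neighbors receive the next consecutive smallest unused labels, in an arbitrary order among themselves. (Thus, if $1$ has $t_1$ neighbors they get labels $2,\ldots,t_1+1$; the $t_2$ unlabeled neighbors of $2$ get labels $t_1+2,\ldots,t_1+t_2+1$; and so on.) The vertices of $T$ are identified with their labels; the root is the vertex $1$. A leaf is a vertex of degree at most $1$ (degree $0$ occurs only when $n=1$). For a homogeneous ideal $I\subset S$, $\mu(I)$ is the cardinality of a minimal homogeneous generating set of $I$, and $S/I$ is a complete intersection if $\mu(I)=\operatorname{height} I$. *)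

theory Defs
  imports
    "HOL-Algebra.Ideal"
    "HOL-Library.Poly_Mapping"
    "HOL-Library.Extended_Nat"
    "Graph_Theory.Pair_Digraph"
begin

section \<open>Polynomial rings\<close>

text \<open>Monomials are finitely supported exponent functions. The type has infinitely many
  variables \<open>x\<^sub>0, x\<^sub>1, \<dots>\<close>; the ring \<open>\<bbbK>[x\<^sub>1, \<dots>, x\<^sub>m]\<close> is carved out as a carrier set, so that
  ideals, prime ideals and generated ideals are those of HOL-Algebra inside that ring.\<close>

type_synonym 'k mpoly = "(nat \<Rightarrow>\<^sub>0 nat) \<Rightarrow>\<^sub>0 'k"

definition var :: "nat \<Rightarrow> 'k::field mpoly" where
  "var i = Poly_Mapping.single (Poly_Mapping.single i 1) 1"

definition poly_ring :: "nat \<Rightarrow> 'k::field mpoly ring" where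
  "poly_ring m =
     \<lparr>carrier = {p. \<forall>t \<in> Poly_Mapping.keys p. Poly_Mapping.keys t \<subseteq> {1..m}},
      monoid.mult = (*), one = 1, ring.zero = 0, add = (+)\<rparr>"

definition monomial_degree :: "(nat \<Rightarrow>\<^sub>0 nat) \<Rightarrow> nat" where
  "monomial_degree t = (\<Sum>i \<in> Poly_Mapping.keys t. Poly_Mapping.lookup t i)"

definition homogeneous :: "'k::field mpoly \<Rightarrow> bool" where
  "homogeneous p \<longleftrightarrow> (\<exists>d. \<forall>t \<in> Poly_Mapping.keys p. monomial_degree t = d)"

lemma var_in_poly_ring: "1 \<le> i \<Longrightarrow> i \<le> m \<Longrightarrow> var i \<in> carrier (poly_ring m)"
  by (auto simp: var_def poly_ring_def)

lemma cring_poly_ring: "cring (poly_ring m :: 'k::field mpoly ring)"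
proof -
  let ?R = "poly_ring m :: 'k mpoly ring"
  have ops: "x \<otimes>\<^bsub>?R\<^esub> y = x * y" "x \<oplus>\<^bsub>?R\<^esub> y = x + y" "\<one>\<^bsub>?R\<^esub> = 1" "\<zero>\<^bsub>?R\<^esub> = 0" for x y
    by (simp_all add: poly_ring_def)
  have mem: "p \<in> carrier ?R \<longleftrightarrow> (\<forall>t \<in> Poly_Mapping.keys p. Poly_Mapping.keys t \<subseteq> {1..m})" for p
    by (simp add: poly_ring_def)
  have add: "p + q \<in> carrier ?R" if "p \<in> carrier ?R" "q \<in> carrier ?R" for p q
    using that Poly_Mapping.keys_add[of p q] unfolding mem by blast
  have mult: "p * q \<in> carrier ?R" if pq: "p \<in> carrier ?R" "q \<in> carrier ?R" for p q
    unfolding mem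
  proof
    fix t assume "t \<in> Poly_Mapping.keys (p * q)"
    with Poly_Mapping.keys_mult[of p q] obtain a b where
      "t = a + b" "a \<in> Poly_Mapping.keys p" "b \<in> Poly_Mapping.keys q" by blast
    then show "Poly_Mapping.keys t \<subseteq> {1..m}"
      using pq Poly_Mapping.keys_add[of a b] unfolding mem by blast
  qed
  have neg: "- p \<in> carrier ?R" if "p \<in> carrier ?R" for p
    using that unfolding mem by (simp add: in_keys_iff)
  have zero_one: "0 \<in> carrier ?R" "1 \<in> carrier ?R"
    by (simp_all add: mem)
  have inverse: "\<exists>q \<in> carrier ?R. p + q = 0" if "p \<in> carrier ?R" for p
    using neg[OF that] by (rule rev_bexI) simp
  show ?thesis
    by (rule cringI; (rule abelian_groupI comm_monoidI)?; unfold ops)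
      (simp_all add: add mult zero_one inverse algebra_simps)
qed


section \<open>Height, number of generators, complete intersections\<close>

definition prime_height :: "('a, 'b) ring_scheme \<Rightarrow> 'a set \<Rightarrow> enat" where
  "prime_height R P = Sup {enat k | k. \<exists>c :: nat \<Rightarrow> 'a set.
     (\<forall>i \<le> k. primeideal (c i) R) \<and> (\<forall>i < k. c i \<subset> c (Suc i)) \<and> c k = P}"

definition ideal_height :: "('a, 'b) ring_scheme \<Rightarrow> 'a set \<Rightarrow> enat" where
  "ideal_height R I = Inf {prime_height R P | P. primeideal P R \<and> I \<subseteq> P}"

definition minimal_homogeneous_generators :: "nat \<Rightarrow> 'k::field mpoly set \<Rightarrow> 'k mpoly set \<Rightarrow> bool"
  where
  "minimal_homogeneous_generators m I A \<longleftrightarrow>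
     A \<subseteq> carrier (poly_ring m) \<and> (\<forall>p \<in> A. homogeneous p) \<and>
     genideal (poly_ring m) A = I \<and> (\<forall>B. B \<subset> A \<longrightarrow> genideal (poly_ring m) B \<noteq> I)"

text \<open>For a homogeneous ideal the choice below is immaterial: a minimal homogeneous generating
  set exists, is finite (\<open>\<bbbK>[x\<^sub>1, \<dots>, x\<^sub>m]\<close> is Noetherian), and by the graded Nakayama lemma all of
  them have the same cardinality.\<close>

definition num_generators :: "nat \<Rightarrow> 'k::field mpoly set \<Rightarrow> nat" where
  "num_generators m I = card (SOME A. minimal_homogeneous_generators m I A)"

text \<open>The property that \<open>\<bbbK>[x\<^sub>1, \<dots>, x\<^sub>m] / I\<close> is a complete intersection, for a homogeneous ideal
  \<open>I\<close>.\<close>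

definition complete_intersection :: "nat \<Rightarrow> 'k::field mpoly set \<Rightarrow> bool" where
  "complete_intersection m I \<longleftrightarrow> enat (num_generators m I) = ideal_height (poly_ring m) I"


section \<open>Graphs, rooted labelings and Hankel edge ideals\<close>

text \<open>Finite simple graphs are the \<^locale>\<open>pair_graph\<close>s of the library: an edge \<open>{u, v}\<close> is
  represented by the two arcs \<open>(u, v)\<close> and \<open>(v, u)\<close>. In particular the out-degree is the degree.\<close>

definition path_graph :: "'v pair_pre_digraph \<Rightarrow> bool" where
  "path_graph G \<longleftrightarrow> pair_graph G \<and>
     (\<exists>vs. vs \<noteq> [] \<and> distinct vs \<and> set vs = pverts G \<and>
        parcs G = {(u, v). \<exists>i. Suc i < length vs \<and> {u, v} = {vs ! i, vs ! Suc i}})"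

definition leaf :: "'v pair_pre_digraph \<Rightarrow> 'v \<Rightarrow> bool" where
  "leaf G v \<longleftrightarrow> v \<in> pverts G \<and> out_degree (with_proj G) v \<le> 1"

text \<open>\<open>bfs G i vs\<close>: a state of the breadth-first labeling process, where \<open>vs\<close> lists the vertices
  labeled so far in increasing order of their labels (so \<open>vs ! k\<close> has label \<open>k + 1\<close>) and the first
  \<open>i\<close> of them have been processed.\<close>

inductive bfs :: "'v pair_pre_digraph \<Rightarrow> nat \<Rightarrow> 'v list \<Rightarrow> bool" for G where
  root: "r \<in> pverts G \<Longrightarrow> bfs G 0 [r]"
| step: "bfs G i vs \<Longrightarrow> i < length vs \<Longrightarrow> distinct ws \<Longrightarrow>
         set ws = {w. (vs ! i, w) \<in> parcs G} - set vs \<Longrightarrow> bfs G (Suc i) (vs @ ws)"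

definition rooted_labeling :: "'v pair_pre_digraph \<Rightarrow> ('v \<Rightarrow> nat) \<Rightarrow> bool" where
  "rooted_labeling G l \<longleftrightarrow>
     (\<exists>vs. bfs G (length vs) vs \<and> set vs = pverts G \<and> (\<forall>k < length vs. l (vs ! k) = k + 1))"

definition relabel :: "('v \<Rightarrow> 'w) \<Rightarrow> 'v pair_pre_digraph \<Rightarrow> 'w pair_pre_digraph" where
  "relabel l G = \<lparr>pverts = l ` pverts G, parcs = (\<lambda>(u, v). (l u, l v)) ` parcs G\<rparr>"

definition hankel_minor :: "nat \<Rightarrow> nat \<Rightarrow> 'k::field mpoly" where
  "hankel_minor i j = var i * var (j + 1) - var j * var (i + 1)"

text \<open>For a graph \<open>G\<close> with vertex set \<open>{1..n}\<close>, an ideal of \<open>\<bbbK>[x\<^sub>1, \<dots>, x\<^sub>n\<^sub>+\<^sub>1]\<close>.\<close>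

definition hankel_edge_ideal :: "nat \<Rightarrow> nat pair_pre_digraph \<Rightarrow> 'k::field mpoly set" where
  "hankel_edge_ideal n G =
     genideal (poly_ring (n + 1)) {hankel_minor i j | i j. i < j \<and> (i, j) \<in> parcs G}"

end

theory Submission
  imports Defs "HOL-Computational_Algebra.Polynomial"
begin

text \<open>Write \<open>P\<close> for a prime containing the ideal \<open>I\<close> of a labelled path. The \<open>n - 1\<close> minors are
  linearly independent quadrics, so they are a minimal generating set and the question is whether
  \<open>I\<close> has height \<open>n - 1\<close>. Heights are computed without Krull's theorem. From above: a chain of primes
  in \<open>\<bbbK>[x\<^sub>1, \<dots>, x\<^sub>m]\<close> has length at most \<open>m\<close>, so a prime that starts a chain of length \<open>j\<close> has height
  at most \<open>m - j\<close>. From below: if \<open>P\<close> contains, for each variable \<open>x\<^sub>v\<close> of a set \<open>W\<close>, a polynomial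
  \<open>a x\<^sub>v + b\<close> with \<open>a \<notin> P\<close> and \<open>a\<close>, \<open>b\<close> in the variables before \<open>x\<^sub>v\<close>, then it has height at least \<open>|W|\<close>.

  A breadth-first labelling of a path is determined by the last label \<open>h\<close> up to which the two sides
  of the root alternate, and the root is a leaf or the neighbour of a leaf iff \<open>h \<le> 4\<close>. The rational
  normal curve always shows that the height is at most \<open>n - 1\<close>. For \<open>h \<le> 4\<close> a case distinction on
  the variables in \<open>P\<close> provides \<open>W\<close> with \<open>n - 1\<close> elements. For \<open>h \<ge> 5\<close> the variables \<open>x\<^sub>2, x\<^sub>3, x\<^sub>4\<close>
  kill the four edges at the vertices 2 and 3 at once, and the height drops below \<open>n - 1\<close>.\<close>


section \<open>The polynomial ring and its monomials\<close>

abbreviation const :: "'k::field \<Rightarrow> 'k mpoly" where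
  "const c \<equiv> Poly_Mapping.single 0 c"

lemma carrier_poly_ring:
  "p \<in> carrier (poly_ring m) \<longleftrightarrow> (\<forall>t \<in> Poly_Mapping.keys p. Poly_Mapping.keys t \<subseteq> {1..m})"
  by (simp add: poly_ring_def)

lemma poly_ring_simps [simp]:
  "x \<otimes>\<^bsub>poly_ring m\<^esub> y = x * y" "x \<oplus>\<^bsub>poly_ring m\<^esub> y = x + y"
  "\<one>\<^bsub>poly_ring m\<^esub> = 1" "\<zero>\<^bsub>poly_ring m\<^esub> = 0"
  by (simp_all add: poly_ring_def)

lemma const_in_poly_ring [simp]: "const c \<in> carrier (poly_ring m)"
  by (simp add: carrier_poly_ring)

lemma const_simps:
  "const 0 = 0" "const 1 = 1" "const (a + b) = const a + const b" "const (a * b) = const a * const b"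
  by (simp_all add: single_add mult_single)

lemma const_uminus: "const (- c) = - const c"
  by (simp add: single_uminus)

lemma poly_ring_closed [simp]:
  fixes p q :: "'k::field mpoly"
  shows "0 \<in> carrier (poly_ring m :: 'k mpoly ring)" "1 \<in> carrier (poly_ring m :: 'k mpoly ring)"
    "p \<in> carrier (poly_ring m) \<Longrightarrow> q \<in> carrier (poly_ring m) \<Longrightarrow> p + q \<in> carrier (poly_ring m)"
    "p \<in> carrier (poly_ring m) \<Longrightarrow> q \<in> carrier (poly_ring m) \<Longrightarrow> p * q \<in> carrier (poly_ring m)"
    "p \<in> carrier (poly_ring m) \<Longrightarrow> - p \<in> carrier (poly_ring m)"
    "p \<in> carrier (poly_ring m) \<Longrightarrow> q \<in> carrier (poly_ring m) \<Longrightarrow> p - q \<in> carrier (poly_ring m)"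
    "p \<in> carrier (poly_ring m) \<Longrightarrow> p ^ d \<in> carrier (poly_ring m)"
proof -
  interpret cring "poly_ring m :: 'k mpoly ring" by (rule cring_poly_ring)
  show zo: "0 \<in> carrier (poly_ring m :: 'k mpoly ring)" "1 \<in> carrier (poly_ring m :: 'k mpoly ring)"
    using zero_closed one_closed by (metis poly_ring_simps)+
  show add: "p + q \<in> carrier (poly_ring m)"
    if "p \<in> carrier (poly_ring m)" "q \<in> carrier (poly_ring m)" for p q :: "'k mpoly"
    using add.m_closed[OF that] by simp
  show mult: "p * q \<in> carrier (poly_ring m)"
    if "p \<in> carrier (poly_ring m)" "q \<in> carrier (poly_ring m)" for p q :: "'k mpoly"
    using m_closed[OF that] by simp
  show neg: "- p \<in> carrier (poly_ring m)" if "p \<in> carrier (poly_ring m)" for p :: "'k mpoly"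
    using that by (simp add: carrier_poly_ring)
  show "p - q \<in> carrier (poly_ring m)"
    if "p \<in> carrier (poly_ring m)" "q \<in> carrier (poly_ring m)" for p q :: "'k mpoly"
    using add[OF that(1) neg[OF that(2)]] by simp
  show "p ^ d \<in> carrier (poly_ring m)" if "p \<in> carrier (poly_ring m)"
    by (induction d) (auto intro: mult that zo)
qed

lemma poly_mapping_sum_single:
  "p = (\<Sum>t \<in> Poly_Mapping.keys p. Poly_Mapping.single t (Poly_Mapping.lookup p t))"
proof (rule poly_mapping_eqI)
  fix t
  have "(\<Sum>s \<in> Poly_Mapping.keys p. Poly_Mapping.lookup (Poly_Mapping.single s (Poly_Mapping.lookup p s)) t)
      = (\<Sum>s \<in> Poly_Mapping.keys p. if s = t then Poly_Mapping.lookup p t else 0)"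
    by (intro sum.cong) (auto simp: lookup_single when_def)
  then show "Poly_Mapping.lookup p t = Poly_Mapping.lookup
      (\<Sum>t \<in> Poly_Mapping.keys p. Poly_Mapping.single t (Poly_Mapping.lookup p t)) t"
    by (simp add: lookup_sum in_keys_iff)
qed

lemma var_power: "var i ^ d = Poly_Mapping.single (Poly_Mapping.single i d) (1 :: 'k::field)"
  by (induction d) (simp_all add: var_def mult_single single_add[symmetric])

lemma monomial_eq_prod_var:
  "Poly_Mapping.single t (1 :: 'k::field)
     = (\<Prod>i \<in> Poly_Mapping.keys t. var i ^ Poly_Mapping.lookup t i)"
proof -
  have "(\<Prod>i \<in> A. var i ^ f i) = Poly_Mapping.single (\<Sum>i \<in> A. Poly_Mapping.single i (f i)) (1 :: 'k)"
    if "finite A" for A and f :: "nat \<Rightarrow> nat"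
    using that by induction (simp_all add: var_power mult_single)
  then show ?thesis
    using poly_mapping_sum_single[of t] by simp
qed

text \<open>The polynomials in the variables \<open>V\<close> form the algebra generated by
  constants and variables, so a statement about homomorphisms only has to be checked there. Keeping
  \<open>V\<close> as a parameter serves both the whole type and the carriers of
  \<open>poly_ring m\<close>.\<close>

lemma mpoly_induct_on [consumes 1, case_names const var add mult]:
  fixes f :: "'k::field mpoly"
  assumes "\<forall>t \<in> Poly_Mapping.keys f. Poly_Mapping.keys t \<subseteq> V"
    and const: "\<And>c. P (const c)" and var: "\<And>i. i \<in> V \<Longrightarrow> P (var i)"
    and add: "\<And>f g. P f \<Longrightarrow> P g \<Longrightarrow> P (f + g)" and mult: "\<And>f g. P f \<Longrightarrow> P g \<Longrightarrow> P (f * g)"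
  shows "P f"
proof -
  have zero: "P 0" and one: "P 1" using const[of 0] const[of 1] by simp_all
  have pow: "P (g ^ d)" if "P g" for g d
    by (induction d) (auto intro: one mult that)
  have mono: "P (Poly_Mapping.single t c)" if "Poly_Mapping.keys t \<subseteq> V" for t c
  proof -
    have "P (\<Prod>i \<in> A. var i ^ Poly_Mapping.lookup t i)" if "finite A" "A \<subseteq> V" for A
      using that by induction (auto intro: one mult pow var)
    then have "P (const c * Poly_Mapping.single t 1)"
      using that by (auto simp: monomial_eq_prod_var intro!: mult const)
    then show ?thesis by (simp add: mult_single)
  qed
  have "P (\<Sum>t \<in> A. Poly_Mapping.single t (Poly_Mapping.lookup f t))"
    if "finite A" "A \<subseteq> Poly_Mapping.keys f" for A
    using that assms(1) by induction (auto intro!: zero add mono)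
  then show ?thesis
    using poly_mapping_sum_single[of f] by (metis finite_keys order_refl)
qed

lemmas mpoly_induct [case_names const var add mult] =
  mpoly_induct_on[where V = UNIV, simplified]

lemma poly_ring_induct [consumes 1, case_names const var add mult]:
  fixes f :: "'k::field mpoly"
  assumes "f \<in> carrier (poly_ring m)"
    and "\<And>c. P (const c)" and "\<And>i. 1 \<le> i \<Longrightarrow> i \<le> m \<Longrightarrow> P (var i)"
    and "\<And>f g. P f \<Longrightarrow> P g \<Longrightarrow> P (f + g)" and "\<And>f g. P f \<Longrightarrow> P g \<Longrightarrow> P (f * g)"
  shows "P f"
  using assms by (intro mpoly_induct_on[of f "{1..m}" P]) (auto simp: carrier_poly_ring)


section \<open>Evaluation homomorphisms\<close>

text \<open>The coefficient map \<open>\<phi>\<close> is a parameter because two targets occur: the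
  polynomials themselves (substitution) and univariate polynomials over them (coefficients with
  respect to one variable).\<close>

definition eval_mpoly :: "('k::field \<Rightarrow> 'a) \<Rightarrow> (nat \<Rightarrow> 'a) \<Rightarrow> 'k mpoly \<Rightarrow> 'a::comm_ring_1" where
  "eval_mpoly \<phi> q f = (\<Sum>t \<in> Poly_Mapping.keys f.
     \<phi> (Poly_Mapping.lookup f t) * (\<Prod>i \<in> Poly_Mapping.keys t. q i ^ Poly_Mapping.lookup t i))"

locale coeff_hom =
  fixes \<phi> :: "'k::field \<Rightarrow> 'a::comm_ring_1"
  assumes hom_0 [simp]: "\<phi> 0 = 0" and hom_1 [simp]: "\<phi> 1 = 1"
    and hom_add: "\<phi> (a + b) = \<phi> a + \<phi> b" and hom_mult: "\<phi> (a * b) = \<phi> a * \<phi> b"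
begin

lemma eval_superset:
  assumes "finite A" "Poly_Mapping.keys f \<subseteq> A"
  shows "eval_mpoly \<phi> q f = (\<Sum>t \<in> A.
     \<phi> (Poly_Mapping.lookup f t) * (\<Prod>i \<in> Poly_Mapping.keys t. q i ^ Poly_Mapping.lookup t i))"
  unfolding eval_mpoly_def using assms
  by (intro sum.mono_neutral_left) (auto simp: in_keys_iff)

lemma eval_0 [simp]: "eval_mpoly \<phi> q 0 = 0"
  by (simp add: eval_mpoly_def)

lemma eval_single:
  "eval_mpoly \<phi> q (Poly_Mapping.single t c) =
     \<phi> c * (\<Prod>i \<in> Poly_Mapping.keys t. q i ^ Poly_Mapping.lookup t i)"
  by (subst eval_superset[of "{t}"]) auto

lemma eval_const [simp]: "eval_mpoly \<phi> q (const c) = \<phi> c"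
  by (simp add: eval_single)

lemma eval_1 [simp]: "eval_mpoly \<phi> q 1 = 1"
  using eval_const[of q 1] by simp

lemma eval_var [simp]: "eval_mpoly \<phi> q (var i) = q i"
  by (simp add: var_def eval_single)

lemma eval_add [simp]: "eval_mpoly \<phi> q (f + g) = eval_mpoly \<phi> q f + eval_mpoly \<phi> q g"
proof -
  let ?A = "Poly_Mapping.keys f \<union> Poly_Mapping.keys g"
  have "Poly_Mapping.keys (f + g) \<subseteq> ?A" by (rule Poly_Mapping.keys_add)
  then show ?thesis
    by (simp add: eval_superset[of ?A] lookup_add hom_add distrib_right sum.distrib)
qed

lemma eval_sum: "eval_mpoly \<phi> q (\<Sum>i \<in> A. f i) = (\<Sum>i \<in> A. eval_mpoly \<phi> q (f i))"
  by (induction A rule: infinite_finite_induct) simp_all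

lemma eval_monomial_mult:
  "eval_mpoly \<phi> q (Poly_Mapping.single s a * Poly_Mapping.single t b) =
   eval_mpoly \<phi> q (Poly_Mapping.single s a) * eval_mpoly \<phi> q (Poly_Mapping.single t b)"
proof -
  let ?A = "Poly_Mapping.keys s \<union> Poly_Mapping.keys t"
  have *: "(\<Prod>i \<in> Poly_Mapping.keys u. q i ^ Poly_Mapping.lookup u i)
      = (\<Prod>i \<in> ?A. q i ^ Poly_Mapping.lookup u i)" if "Poly_Mapping.keys u \<subseteq> ?A" for u
    using that by (intro prod.mono_neutral_left) (auto simp: in_keys_iff)
  have "(\<Prod>i \<in> Poly_Mapping.keys (s + t). q i ^ Poly_Mapping.lookup (s + t) i) =
      (\<Prod>i \<in> Poly_Mapping.keys s. q i ^ Poly_Mapping.lookup s i) *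
      (\<Prod>i \<in> Poly_Mapping.keys t. q i ^ Poly_Mapping.lookup t i)"
    using *[of s] *[of t] *[OF Poly_Mapping.keys_add]
    by (simp add: lookup_add power_add prod.distrib)
  then show ?thesis
    by (simp add: mult_single eval_single hom_mult mult_ac)
qed

lemma eval_mult [simp]: "eval_mpoly \<phi> q (f * g) = eval_mpoly \<phi> q f * eval_mpoly \<phi> q g"
proof -
  have "f * g = (\<Sum>s \<in> Poly_Mapping.keys f. \<Sum>t \<in> Poly_Mapping.keys g.
      Poly_Mapping.single s (Poly_Mapping.lookup f s) * Poly_Mapping.single t (Poly_Mapping.lookup g t))"
    by (subst poly_mapping_sum_single[of f], subst poly_mapping_sum_single[of g])
      (simp add: sum_product)
  then have "eval_mpoly \<phi> q (f * g) =
      eval_mpoly \<phi> q (\<Sum>s \<in> Poly_Mapping.keys f. Poly_Mapping.single s (Poly_Mapping.lookup f s)) *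
      eval_mpoly \<phi> q (\<Sum>t \<in> Poly_Mapping.keys g. Poly_Mapping.single t (Poly_Mapping.lookup g t))"
    by (simp add: eval_sum eval_monomial_mult sum_product)
  then show ?thesis
    by (simp add: poly_mapping_sum_single[symmetric])
qed

lemma eval_uminus [simp]: "eval_mpoly \<phi> q (- f) = - eval_mpoly \<phi> q f"
  using eval_add[of q f "- f"] by (simp add: eq_neg_iff_add_eq_0 add.commute)

lemma eval_diff [simp]: "eval_mpoly \<phi> q (f - g) = eval_mpoly \<phi> q f - eval_mpoly \<phi> q g"
  using eval_add[of q f "- g"] by simp

lemma eval_power [simp]: "eval_mpoly \<phi> q (f ^ d) = eval_mpoly \<phi> q f ^ d"
  by (induction d) simp_all

end

abbreviation subst_mpoly :: "(nat \<Rightarrow> 'k mpoly) \<Rightarrow> 'k::field mpoly \<Rightarrow> 'k mpoly" where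
  "subst_mpoly \<equiv> eval_mpoly const"

interpretation subst: coeff_hom "const :: 'k::field \<Rightarrow> 'k mpoly"
  by standard (simp_all add: const_simps)

lemma subst_subst: "subst_mpoly r (subst_mpoly q f) = subst_mpoly (\<lambda>i. subst_mpoly r (q i)) f"
  by (induction f rule: mpoly_induct) simp_all


section \<open>Prime ideals of the polynomial ring\<close>

lemma ideal_poly_ringI:
  fixes I :: "'k::field mpoly set"
  assumes sub: "I \<subseteq> carrier (poly_ring m)" and zero: "0 \<in> I"
    and add: "\<And>f g. f \<in> I \<Longrightarrow> g \<in> I \<Longrightarrow> f + g \<in> I"
    and mult: "\<And>f r. f \<in> I \<Longrightarrow> r \<in> carrier (poly_ring m) \<Longrightarrow> r * f \<in> I"
  shows "ideal I (poly_ring m)"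
proof -
  let ?R = "poly_ring m :: 'k mpoly ring"
  interpret cring ?R by (rule cring_poly_ring)
  have inv: "\<ominus>\<^bsub>?R\<^esub> f = - f" if "f \<in> carrier ?R" for f
    by (rule minus_equality) (use that in simp_all)
  have neg: "- f \<in> I" if "f \<in> I" for f
    using mult[OF that, of "const (- 1)"] by (simp add: const_uminus)
  show ?thesis
  proof (rule idealI)
    show "subgroup I (add_monoid ?R)"
    proof (rule add.subgroupI)
      show "\<ominus>\<^bsub>?R\<^esub> f \<in> I" if "f \<in> I" for f
        using neg[OF that] inv sub that by auto
    qed (use sub zero add in auto)
  qed (use mult in \<open>auto simp: mult.commute intro: ring_axioms\<close>)
qed

lemma ideal_poly_ringD:
  fixes I :: "'k::field mpoly set"
  assumes "ideal I (poly_ring m)"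
  shows "I \<subseteq> carrier (poly_ring m)" "0 \<in> I"
    "f \<in> I \<Longrightarrow> g \<in> I \<Longrightarrow> f + g \<in> I"
    "f \<in> I \<Longrightarrow> r \<in> carrier (poly_ring m) \<Longrightarrow> r * f \<in> I"
    "f \<in> I \<Longrightarrow> r \<in> carrier (poly_ring m) \<Longrightarrow> f * r \<in> I"
proof -
  interpret ideal I "poly_ring m" by fact
  show "I \<subseteq> carrier (poly_ring m)" by (rule a_subset)
  show "0 \<in> I" using additive_subgroup.zero_closed[OF is_additive_subgroup] by simp
  show "f \<in> I \<Longrightarrow> g \<in> I \<Longrightarrow> f + g \<in> I"
    using additive_subgroup.a_closed[OF is_additive_subgroup, of f g] by simp
  show "f \<in> I \<Longrightarrow> r \<in> carrier (poly_ring m) \<Longrightarrow> r * f \<in> I"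
    using I_l_closed[of f r] by simp
  show "f \<in> I \<Longrightarrow> r \<in> carrier (poly_ring m) \<Longrightarrow> f * r \<in> I"
    using I_r_closed[of f r] by simp
qed

lemma ideal_poly_ring_sub:
  fixes I :: "'k::field mpoly set"
  assumes "ideal I (poly_ring m)" "f \<in> I" "g \<in> I"
  shows "f - g \<in> I"
  using ideal_poly_ringD(3)[OF assms(1,2), of "- g"]
    ideal_poly_ringD(4)[OF assms(1,3), of "const (- 1)"] by (simp add: const_uminus)

lemma primeideal_poly_ringI:
  fixes P :: "'k::field mpoly set"
  assumes "ideal P (poly_ring m)" and "1 \<notin> P"
    and "\<And>f g. f \<in> carrier (poly_ring m) \<Longrightarrow> g \<in> carrier (poly_ring m) \<Longrightarrow> f * g \<in> P \<Longrightarrow> f \<in> P \<or> g \<in> P"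
  shows "primeideal P (poly_ring m)"
proof (rule primeidealI)
  show "carrier (poly_ring m) \<noteq> P" using assms(2) by (metis poly_ring_closed(2))
qed (use assms cring_poly_ring in auto)

lemma primeideal_poly_ringD:
  fixes P :: "'k::field mpoly set"
  assumes "primeideal P (poly_ring m)"
  shows "ideal P (poly_ring m)" "1 \<notin> P"
    "f \<in> carrier (poly_ring m) \<Longrightarrow> g \<in> carrier (poly_ring m) \<Longrightarrow> f * g \<in> P \<Longrightarrow> f \<in> P \<or> g \<in> P"
proof -
  interpret primeideal P "poly_ring m" by fact
  show I: "ideal P (poly_ring m)" by (rule is_ideal)
  show "1 \<notin> P"
  proof
    assume "1 \<in> P"
    then have "carrier (poly_ring m) \<subseteq> P"
      using ideal_poly_ringD(4)[OF I, of 1] by auto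
    then show False using ideal_poly_ringD(1)[OF I] I_notcarr by blast
  qed
  show "f \<in> carrier (poly_ring m) \<Longrightarrow> g \<in> carrier (poly_ring m) \<Longrightarrow> f * g \<in> P \<Longrightarrow> f \<in> P \<or> g \<in> P"
    using I_prime[of f g] by simp
qed

section \<open>Primes as kernels, and primes extended from fewer variables\<close>

definition subst_kernel :: "nat \<Rightarrow> (nat \<Rightarrow> 'k mpoly) \<Rightarrow> 'k::field mpoly set" where
  "subst_kernel m q = {f \<in> carrier (poly_ring m). subst_mpoly q f = 0}"

text \<open>Substitution is a homomorphism into an integral domain, so its kernel is prime. The
  kernel consists of the polynomial relations between the \<open>q i\<close>; all explicit primes
  below arise in this way.\<close>

lemma primeideal_subst_kernel: "primeideal (subst_kernel m q) (poly_ring m)"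
  by (intro primeideal_poly_ringI ideal_poly_ringI) (auto simp: subst_kernel_def)

text \<open>Reads a polynomial as univariate in \<open>var v\<close>. The coefficients stay in the
  original type, so that they can be tested for membership in ideals of the original ring.\<close>

definition coeffs_in :: "nat \<Rightarrow> 'k::field mpoly \<Rightarrow> 'k mpoly poly" where
  "coeffs_in v = eval_mpoly (\<lambda>c. [:const c:]) (\<lambda>i. if i = v then [:0, 1:] else [:var i:])"

interpretation coeffs_in: coeff_hom "\<lambda>c :: 'k::field. [:const c:]"
  by standard (simp_all add: const_simps one_pCons)

lemma coeffs_in_simps [simp]:
  "coeffs_in v 0 = 0" "coeffs_in v 1 = 1" "coeffs_in v (const c) = [:const c:]"
  "coeffs_in v (var i) = (if i = v then [:0, 1:] else [:var i:])"
  "coeffs_in v (f + g) = coeffs_in v f + coeffs_in v g"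
  "coeffs_in v (f - g) = coeffs_in v f - coeffs_in v g"
  "coeffs_in v (f * g) = coeffs_in v f * coeffs_in v g"
  "coeffs_in v (f ^ d) = coeffs_in v f ^ d"
  by (simp_all add: coeffs_in_def)

lemma poly_coeffs_in: "poly (coeffs_in v f) (var v) = f"
  by (induction f rule: mpoly_induct) simp_all

lemma coeff_coeffs_in_closed:
  assumes "f \<in> carrier (poly_ring m)"
  shows "coeff (coeffs_in v f) d \<in> carrier (poly_ring m)"
proof -
  let ?C = "\<lambda>f. \<forall>d. coeff (coeffs_in v f) d \<in> carrier (poly_ring m)"
  have sum: "(\<Sum>i \<in> A. h i) \<in> carrier (poly_ring m)"
    if "\<And>i. h i \<in> carrier (poly_ring m)" for A :: "nat set" and h :: "nat \<Rightarrow> 'a mpoly"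
    using that by (induction A rule: infinite_finite_induct) auto
  have "?C f"
    using assms
  proof (induction rule: poly_ring_induct)
    case (const c) then show ?case by (auto simp: coeff_pCons split: nat.split)
  next
    case (var i) then show ?case
      by (auto simp: coeff_pCons var_in_poly_ring split: nat.split)
  next
    case (mult f g) then show ?case by (auto simp: coeff_mult intro!: sum)
  qed simp
  then show ?thesis by blast
qed

text \<open>The largest ideal contained in \<open>P\<close> that is extended from the subring of polynomials not
  involving \<open>x\<^sub>v\<close>.\<close>

definition extended_part :: "nat \<Rightarrow> nat \<Rightarrow> 'k::field mpoly set \<Rightarrow> 'k mpoly set" where
  "extended_part m v P = {f \<in> carrier (poly_ring m). \<forall>d. coeff (coeffs_in v f) d \<in> P}"

lemma ideal_sum_closed:
  fixes P :: "'k::field mpoly set"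
  assumes "ideal P (poly_ring m)" "\<And>i. i \<in> A \<Longrightarrow> h i \<in> P"
  shows "(\<Sum>i \<in> A. h i) \<in> P"
  using assms(2)
  by (induction A rule: infinite_finite_induct) (auto intro: ideal_poly_ringD[OF assms(1)])

lemma ideal_extended_part:
  fixes P :: "'k::field mpoly set"
  assumes "ideal P (poly_ring m)"
  shows "ideal (extended_part m v P) (poly_ring m)"
proof (rule ideal_poly_ringI)
  fix f r :: "'k mpoly" assume f: "f \<in> extended_part m v P" and r: "r \<in> carrier (poly_ring m)"
  have "coeff (coeffs_in v (r * f)) d \<in> P" for d
    unfolding coeffs_in_simps coeff_mult using f r
    by (intro ideal_sum_closed[OF assms] ideal_poly_ringD(4)[OF assms])
      (auto simp: extended_part_def coeff_coeffs_in_closed)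
  then show "r * f \<in> extended_part m v P"
    using f r by (auto simp: extended_part_def)
qed (auto simp: extended_part_def intro: ideal_poly_ringD[OF assms])

lemma extended_part_subset:
  fixes P :: "'k::field mpoly set"
  assumes "ideal P (poly_ring m)" "1 \<le> v" "v \<le> m"
  shows "extended_part m v P \<subseteq> P"
proof
  fix f assume f: "f \<in> extended_part m v P"
  have "f = (\<Sum>d \<le> degree (coeffs_in v f). coeff (coeffs_in v f) d * var v ^ d)"
    using poly_coeffs_in[of v f] by (simp add: poly_altdef)
  also have "\<dots> \<in> P"
    using f assms by (intro ideal_sum_closed[OF assms(1)] ideal_poly_ringD(5)[OF assms(1)])
      (auto simp: extended_part_def var_in_poly_ring)
  finally show "f \<in> P" .
qed

text \<open>Gauss's argument: if neither factor has all its coefficients in \<open>P\<close>, then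
  the product of their last coefficients outside \<open>P\<close> survives modulo
  \<open>P\<close>.\<close>

lemma primeideal_extended_part:
  fixes P :: "'k::field mpoly set"
  assumes P: "primeideal P (poly_ring m)" and v: "1 \<le> v" "v \<le> m"
  shows "primeideal (extended_part m v P) (poly_ring m)"
proof (rule primeideal_poly_ringI)
  note I = primeideal_poly_ringD(1)[OF P]
  show "ideal (extended_part m v P) (poly_ring m)" by (rule ideal_extended_part[OF I])
  show "1 \<notin> extended_part m v P"
    using extended_part_subset[OF I v] primeideal_poly_ringD(2)[OF P] by blast
  fix f g assume f: "f \<in> carrier (poly_ring m)" and g: "g \<in> carrier (poly_ring m)"
    and fg: "f * g \<in> extended_part m v P"
  define A where "A h = {d. coeff (coeffs_in v h) d \<notin> P}" for h
  show "f \<in> extended_part m v P \<or> g \<in> extended_part m v P"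
  proof (rule ccontr)
    assume "\<not> ?thesis"
    then have ne: "A f \<noteq> {}" "A g \<noteq> {}"
      using f g by (auto simp: extended_part_def A_def)
    have fin: "finite (A h)" for h
      using ideal_poly_ringD(2)[OF I] le_degree
      by (intro finite_subset[of "A h" "{..degree (coeffs_in v h)}"]) (force simp: A_def)+
    \<comment> \<open>In the coefficient of index \<open>a + b\<close> of the product, every term
      but one has a factor of index beyond \<open>a\<close> or beyond \<open>b\<close>, hence in
      \<open>P\<close>.\<close>
    define a b where "a = Max (A f)" and "b = Max (A g)"
    have a: "a \<in> A f" and b: "b \<in> A g"
      using ne fin by (simp_all add: a_def b_def)
    have big: "coeff (coeffs_in v f) i * coeff (coeffs_in v g) (a + b - i) \<in> P"
      if "i \<le> a + b" "i \<noteq> a" for i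
    proof (cases "i < a")
      case True
      then have "a + b - i \<notin> A g" using Max_ge[OF fin, of "a + b - i" g] by (auto simp: b_def)
      then show ?thesis
        using f by (intro ideal_poly_ringD(4)[OF I]) (auto simp: A_def coeff_coeffs_in_closed)
    next
      case False
      then have "i \<notin> A f" using that Max_ge[OF fin, of i f] by (auto simp: a_def)
      then show ?thesis
        using g by (intro ideal_poly_ringD(5)[OF I]) (auto simp: A_def coeff_coeffs_in_closed)
    qed
    have "coeff (coeffs_in v (f * g)) (a + b) =
      coeff (coeffs_in v f) a * coeff (coeffs_in v g) b +
      (\<Sum>i \<in> {..a + b} - {a}. coeff (coeffs_in v f) i * coeff (coeffs_in v g) (a + b - i))"
      by (simp add: coeff_mult sum.remove[of _ a])
    moreover have "(\<Sum>i \<in> {..a + b} - {a}. coeff (coeffs_in v f) i * coeff (coeffs_in v g) (a + b - i)) \<in> P"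
      by (rule ideal_sum_closed[OF I]) (auto intro: big)
    moreover have "coeff (coeffs_in v (f * g)) (a + b) \<in> P"
      using fg by (simp add: extended_part_def)
    ultimately have "coeff (coeffs_in v f) a * coeff (coeffs_in v g) b \<in> P"
      using ideal_poly_ring_sub[OF I, of "coeff (coeffs_in v (f * g)) (a + b)"] by fastforce
    then have "coeff (coeffs_in v f) a \<in> P \<or> coeff (coeffs_in v g) b \<in> P"
      using f g by (intro primeideal_poly_ringD(3)[OF P]) (auto simp: coeff_coeffs_in_closed)
    then show False using a b by (simp add: A_def)
  qed
qed


section \<open>Chains of prime ideals\<close>

definition prime_chain :: "('a, 'b) ring_scheme \<Rightarrow> nat \<Rightarrow> (nat \<Rightarrow> 'a set) \<Rightarrow> bool" where
  "prime_chain R k c \<longleftrightarrow> (\<forall>i \<le> k. primeideal (c i) R) \<and> (\<forall>i < k. c i \<subset> c (Suc i))"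

lemma prime_height_prime_chain:
  "prime_height R P = Sup {enat k | k. \<exists>c. prime_chain R k c \<and> c k = P}"
  by (simp add: prime_height_def prime_chain_def conj_assoc)

lemma prime_chain_extend:
  assumes "prime_chain R k c" "primeideal P R" "c k \<subset> P"
  shows "prime_chain R (Suc k) (c(Suc k := P))"
  using assms by (auto simp: prime_chain_def le_Suc_eq less_Suc_eq)

lemma prime_chain_append:
  assumes "prime_chain R k c" "prime_chain R j d" "d 0 = c k"
  shows "prime_chain R (k + j) (\<lambda>i. if i \<le> k then c i else d (i - k))"
  unfolding prime_chain_def
proof (intro conjI allI impI)
  fix i assume "i \<le> k + j"
  then show "primeideal (if i \<le> k then c i else d (i - k)) R"
    using assms by (auto simp: prime_chain_def)
next
  fix i assume "i < k + j"
  moreover have "d (i - k) \<subset> d (Suc (i - k))" if "k \<le> i" "i < k + j"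
    using assms(2) that by (auto simp: prime_chain_def)
  ultimately show "(if i \<le> k then c i else d (i - k)) \<subset> (if Suc i \<le> k then c (Suc i) else d (Suc i - k))"
    using assms by (cases "i < k"; cases "i = k") (auto simp: prime_chain_def Suc_diff_le)
qed

lemma coeffs_in_unused:
  assumes "f \<in> carrier (poly_ring k)" "k < v"
  shows "coeffs_in v f = [:f:]"
  using assms by (induction rule: poly_ring_induct) (simp_all add: mult.commute)

text \<open>Passing from \<open>P\<close> to its extended part with respect to the largest variable in \<open>W\<close> is a
  strict step down, because \<open>a x\<^sub>v + b\<close> has a coefficient outside of \<open>P\<close>.\<close>

lemma prime_chain_triangular:
  fixes P :: "'k::field mpoly set"
  assumes "finite W" "W \<subseteq> {1..m}" "primeideal P (poly_ring m)"
    and "\<And>v. v \<in> W \<Longrightarrow> \<exists>a \<in> carrier (poly_ring (v - 1)). \<exists>b \<in> carrier (poly_ring (v - 1)).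
      a \<notin> P \<and> a * var v + b \<in> P"
  shows "\<exists>c. prime_chain (poly_ring m) (card W) c \<and> c (card W) = P"
  using assms
proof (induction W arbitrary: P rule: finite_linorder_max_induct)
  case empty
  then show ?case by (intro exI[of _ "\<lambda>_. P"]) (simp add: prime_chain_def)
next
  case (insert w W)
  define Q where "Q = extended_part m w P"
  have w: "1 \<le> w" "w \<le> m" using insert.prems(1) by auto
  have QP: "Q \<subseteq> P"
    unfolding Q_def using extended_part_subset primeideal_poly_ringD(1) insert.prems(2) w by blast
  have Q: "primeideal Q (poly_ring m)"
    unfolding Q_def by (rule primeideal_extended_part[OF insert.prems(2) w])
  have "\<exists>c. prime_chain (poly_ring m) (card W) c \<and> c (card W) = Q"
  proof (rule insert.IH[OF _ Q])
    \<comment> \<open>The polynomials for the smaller \<open>v\<close> do not involve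
      \<open>var w\<close>; each is its own constant coefficient and so stays in
      \<open>Q\<close>.\<close>
    fix v assume v: "v \<in> W"
    then have vw: "v < w" "1 \<le> v" using insert.hyps insert.prems(1) by auto
    obtain a b where ab: "a \<in> carrier (poly_ring (v - 1))" "b \<in> carrier (poly_ring (v - 1))"
      "a \<notin> P" "a * var v + b \<in> P"
      using insert.prems(3)[of v] v by blast
    have "a * var v + b \<in> carrier (poly_ring m)"
      using ideal_poly_ringD(1)[OF primeideal_poly_ringD(1)[OF insert.prems(2)]] ab(4) by blast
    moreover have "coeffs_in w (a * var v + b) = [:a * var v + b:]"
      using ab(1,2) vw by (simp add: coeffs_in_unused mult.commute)
    moreover have "0 \<in> P"
      using ideal_poly_ringD(2)[OF primeideal_poly_ringD(1)[OF insert.prems(2)]] .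
    ultimately have "a * var v + b \<in> Q"
      using ab(4) by (auto simp: Q_def extended_part_def coeff_pCons split: nat.split)
    then show "\<exists>a \<in> carrier (poly_ring (v - 1)). \<exists>b \<in> carrier (poly_ring (v - 1)).
      a \<notin> Q \<and> a * var v + b \<in> Q"
      using ab QP by blast
  qed (use insert.prems in auto)
  then obtain c where c: "prime_chain (poly_ring m) (card W) c" "c (card W) = Q" by blast
  obtain a b where ab: "a \<in> carrier (poly_ring (w - 1))" "b \<in> carrier (poly_ring (w - 1))"
      "a \<notin> P" "a * var w + b \<in> P"
    using insert.prems(3)[of w] by blast
  have "coeffs_in w (a * var w + b) = [:b, a:]"
    using ab(1,2) w by (simp add: coeffs_in_unused)
  then have "a * var w + b \<notin> Q"
    using ab(3) by (auto simp: Q_def extended_part_def intro!: exI[of _ 1])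
  then have "Q \<subset> P" using QP ab(4) by blast
  then have "prime_chain (poly_ring m) (Suc (card W)) (c(Suc (card W) := P))"
    using c insert.prems(2) by (intro prime_chain_extend) auto
  moreover have "card (insert w W) = Suc (card W)" using insert.hyps by auto
  ultimately show ?case by (intro exI[of _ "c(Suc (card W) := P)"]) (simp del: fun_upd_apply, simp)
qed

lemma prime_height_ge_triangular:
  fixes P :: "'k::field mpoly set"
  assumes "W \<subseteq> {1..m}" "primeideal P (poly_ring m)"
    and "\<And>v. v \<in> W \<Longrightarrow> \<exists>a \<in> carrier (poly_ring (v - 1)). \<exists>b \<in> carrier (poly_ring (v - 1)).
      a \<notin> P \<and> a * var v + b \<in> P"
  shows "enat (card W) \<le> prime_height (poly_ring m) P"
  unfolding prime_height_prime_chain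
  by (rule Sup_upper) (use prime_chain_triangular[OF _ assms] assms(1) finite_subset in auto)


section \<open>Dimension of the polynomial ring\<close>

interpretation mpoly: vector_space "\<lambda>c :: 'k::field. (*) (const c) :: 'k mpoly \<Rightarrow> 'k mpoly"
  by standard (simp_all add: const_simps algebra_simps)

text \<open>The family is indexed by \<open>A\<close> so that repetitions count: two equal members
  give a relation with coefficients 1 and -1, and an injective family has too large an image to be
  independent.\<close>

lemma (in vector_space) nontrivial_relation:
  assumes "finite A" "F ` A \<subseteq> span B" "finite B" "card B < card A"
  shows "\<exists>c. (\<exists>a \<in> A. c a \<noteq> 0) \<and> (\<Sum>a \<in> A. scale (c a) (F a)) = 0"
proof (cases "inj_on F A")
  case True
  then have "card (F ` A) = card A" by (rule card_image)
  then have "dependent (F ` A)"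
    using independent_span_bound[OF assms(3) _ assms(2)] assms(4) by fastforce
  then obtain u where u: "\<exists>v \<in> F ` A. u v \<noteq> 0" "(\<Sum>v \<in> F ` A. scale (u v) v) = 0"
    using dependent_finite[of "F ` A"] assms(1) by auto
  then show ?thesis
    using True by (intro exI[of _ "\<lambda>a. u (F a)"]) (auto simp: sum.reindex)
next
  case False
  then obtain a b where ab: "a \<in> A" "b \<in> A" "a \<noteq> b" "F a = F b" by (auto simp: inj_on_def)
  let ?c = "\<lambda>x. if x = a then 1 else if x = b then - 1 else 0"
  have "(\<Sum>x \<in> A. scale (?c x) (F x)) = (\<Sum>x \<in> {a, b}. scale (?c x) (F x))"
    using ab assms(1) by (intro sum.mono_neutral_right) auto
  also have "\<dots> = 0" using ab by simp
  finally show ?thesis using ab by (intro exI[of _ ?c]) auto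
qed

text \<open>Bounding each exponent separately, instead of the total degree, makes this a cube, which
  is easy to count.\<close>

definition exponent_box :: "nat \<Rightarrow> nat \<Rightarrow> (nat \<Rightarrow>\<^sub>0 nat) set" where
  "exponent_box m B = {t. Poly_Mapping.keys t \<subseteq> {1..m} \<and> (\<forall>i. Poly_Mapping.lookup t i \<le> B)}"

lemma exponent_box_finite_card:
  "finite (exponent_box m B)" "card (exponent_box m B) \<le> (B + 1) ^ m"
proof -
  let ?r = "\<lambda>t. restrict (Poly_Mapping.lookup t) {1..m}"
  have inj: "inj_on ?r (exponent_box m B)"
  proof (rule inj_onI, rule poly_mapping_eqI)
    fix s t i assume "s \<in> exponent_box m B" "t \<in> exponent_box m B" and eq: "?r s = ?r t"
    then have "i \<notin> {1..m} \<Longrightarrow> Poly_Mapping.lookup s i = 0 \<and> Poly_Mapping.lookup t i = 0"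
      by (auto simp: exponent_box_def in_keys_iff subset_iff)
    moreover have "i \<in> {1..m} \<Longrightarrow> Poly_Mapping.lookup s i = Poly_Mapping.lookup t i"
      using fun_cong[OF eq, of i] by simp
    ultimately show "Poly_Mapping.lookup s i = Poly_Mapping.lookup t i" by metis
  qed
  have sub: "?r ` exponent_box m B \<subseteq> (\<Pi>\<^sub>E i \<in> {1..m}. {..B})"
    by (auto simp: exponent_box_def)
  have fin: "finite (\<Pi>\<^sub>E i \<in> {1..m}. {..B})" by (intro finite_PiE) auto
  then show "finite (exponent_box m B)" using inj sub by (meson finite_imageD finite_subset)
  show "card (exponent_box m B) \<le> (B + 1) ^ m"
    using card_mono[OF fin sub] unfolding card_image[OF inj] by (simp add: card_PiE)
qed

definition bounded_exponents :: "nat \<Rightarrow> nat \<Rightarrow> 'k::field mpoly set" where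
  "bounded_exponents m B = {p. Poly_Mapping.keys p \<subseteq> exponent_box m B}"

lemma bounded_exponents_one: "1 \<in> bounded_exponents m B"
  by (auto simp: bounded_exponents_def exponent_box_def)

lemma bounded_exponents_mono: "B \<le> C \<Longrightarrow> bounded_exponents m B \<subseteq> bounded_exponents m C"
  by (auto simp: bounded_exponents_def exponent_box_def intro: order_trans)

lemma bounded_exponents_mult:
  assumes "p \<in> bounded_exponents m B" "q \<in> bounded_exponents m C"
  shows "p * q \<in> bounded_exponents m (B + C)"
  unfolding bounded_exponents_def
proof (intro CollectI subsetI)
  fix t assume "t \<in> Poly_Mapping.keys (p * q)"
  then obtain a b where t: "t = a + b" "a \<in> Poly_Mapping.keys p" "b \<in> Poly_Mapping.keys q"
    using Poly_Mapping.keys_mult[of p q] by blast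
  then have "a \<in> exponent_box m B" "b \<in> exponent_box m C"
    using assms by (auto simp: bounded_exponents_def)
  then show "t \<in> exponent_box m (B + C)"
    using Poly_Mapping.keys_add[of a b] unfolding t(1)
    by (auto simp: exponent_box_def lookup_add add_mono)
qed

lemma bounded_exponents_power:
  "p \<in> bounded_exponents m B \<Longrightarrow> p ^ d \<in> bounded_exponents m (d * B)"
  by (induction d) (auto intro: bounded_exponents_one bounded_exponents_mult)

lemma bounded_exponents_prod:
  assumes "finite A" "\<And>i. i \<in> A \<Longrightarrow> h i \<in> bounded_exponents m B"
  shows "(\<Prod>i \<in> A. h i) \<in> bounded_exponents m (card A * B)"
  using assms by (induction A) (auto intro: bounded_exponents_one bounded_exponents_mult)

lemma bounded_exponents_span:
  assumes "p \<in> bounded_exponents m B"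
  shows "p \<in> mpoly.span ((\<lambda>t. Poly_Mapping.single t 1) ` exponent_box m B)"
proof -
  have "(\<Sum>t \<in> Poly_Mapping.keys p. const (Poly_Mapping.lookup p t) * Poly_Mapping.single t 1)
    \<in> mpoly.span ((\<lambda>t. Poly_Mapping.single t 1) ` exponent_box m B)"
    using assms by (intro mpoly.span_sum mpoly.span_scale mpoly.span_base)
      (auto simp: bounded_exponents_def)
  then show ?thesis
    by (simp add: mult_single poly_mapping_sum_single[symmetric])
qed

lemma poly_ring_bounded_exponents:
  assumes "p \<in> carrier (poly_ring m)"
  shows "\<exists>B. p \<in> bounded_exponents m B"
proof -
  define B where "B = (\<Sum>t \<in> Poly_Mapping.keys p. \<Sum>i \<in> Poly_Mapping.keys t. Poly_Mapping.lookup t i)"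
  have "Poly_Mapping.lookup t i \<le> B" if t: "t \<in> Poly_Mapping.keys p" for t i
  proof (cases "i \<in> Poly_Mapping.keys t")
    case True
    then have "Poly_Mapping.lookup t i \<le> (\<Sum>i \<in> Poly_Mapping.keys t. Poly_Mapping.lookup t i)"
      by (intro member_le_sum) auto
    also have "\<dots> \<le> B" unfolding B_def
      using t by (intro member_le_sum[of t _ "\<lambda>t. \<Sum>i \<in> Poly_Mapping.keys t. Poly_Mapping.lookup t i"]) auto
    finally show ?thesis .
  qed (simp add: in_keys_iff)
  then show ?thesis
    using assms by (intro exI[of _ B]) (auto simp: bounded_exponents_def exponent_box_def carrier_poly_ring)
qed

text \<open>A count: there are \<open>D ^ (m + 1)\<close> power products with exponents below
  \<open>D\<close>, while their monomials lie in a cube of dimension \<open>m\<close> whose side is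
  linear in \<open>D\<close>. Extensional exponent functions are determined by their values on
  \<open>{..m}\<close>.\<close>

lemma algebraically_dependent:
  fixes f :: "nat \<Rightarrow> 'k::field mpoly"
  assumes f: "\<And>j. j \<le> m \<Longrightarrow> f j \<in> carrier (poly_ring m)"
  shows "\<exists>A c. finite A \<and> A \<noteq> {} \<and> A \<subseteq> extensional {..m} \<and> (\<forall>a \<in> A. c a \<noteq> 0) \<and>
    (\<Sum>a \<in> A. const (c a) * (\<Prod>j \<le> m. f j ^ a j)) = 0"
proof -
  have "\<exists>b. \<forall>j \<le> m. f j \<in> bounded_exponents m (b j)"
    using poly_ring_bounded_exponents[OF f] by metis
  then obtain b where b: "\<And>j. j \<le> m \<Longrightarrow> f j \<in> bounded_exponents m (b j)" by blast
  define e where "e = (\<Sum>j \<le> m. b j)"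
  have fe: "f j \<in> bounded_exponents m e" if "j \<le> m" for j
  proof -
    have "b j \<le> e" unfolding e_def using that by (intro member_le_sum) auto
    then show ?thesis using b[OF that] bounded_exponents_mono by blast
  qed
  \<comment> \<open>Chosen such that the exponent bound \<open>N\<close> below satisfies
    \<open>N + 1 \<le> M * D\<close>, while \<open>M ^ m < D\<close>. Hence
    \<open>(N + 1) ^ m < D ^ (m + 1)\<close>.\<close>
  define M where "M = (m + 1) * e + 1"
  define D where "D = M ^ m + 1"
  define E where "E = (\<Pi>\<^sub>E j \<in> {..m}. {..<D})"
  have finE: "finite E" by (auto simp: E_def intro!: finite_PiE)
  have cardE: "card E = D ^ (m + 1)" by (simp add: E_def card_PiE)
  let ?F = "\<lambda>a. \<Prod>j \<le> m. f j ^ a j"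
  define N where "N = (m + 1) * ((D - 1) * e)"
  have "?F a \<in> bounded_exponents m N" if a: "a \<in> E" for a
  proof -
    have "f j ^ a j \<in> bounded_exponents m ((D - 1) * e)" if "j \<in> {..m}" for j
    proof -
      have "a j < D" using a that by (auto simp: E_def)
      then have "a j * e \<le> (D - 1) * e" by (intro mult_right_mono) auto
      then show ?thesis
        using bounded_exponents_mono bounded_exponents_power[OF fe[of j], of "a j"] that by blast
    qed
    then show ?thesis
      using bounded_exponents_prod[of "{..m}" "\<lambda>j. f j ^ a j" m "(D - 1) * e"] by (simp add: N_def)
  qed
  then have span: "?F ` E \<subseteq> mpoly.span ((\<lambda>t. Poly_Mapping.single t 1) ` exponent_box m N)"
    using bounded_exponents_span by blast
  have "N + 1 \<le> M * D"
    by (simp add: N_def M_def D_def algebra_simps)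
  then have "(N + 1) ^ m \<le> (M * D) ^ m" by (rule power_mono) simp
  also have "\<dots> = M ^ m * D ^ m" by (simp add: power_mult_distrib)
  also have "\<dots> < D * D ^ m" by (simp add: D_def)
  finally have lt: "(N + 1) ^ m < card E" by (simp add: cardE)
  have "card ((\<lambda>t. Poly_Mapping.single t (1 :: 'k)) ` exponent_box m N) \<le> (N + 1) ^ m"
    using card_image_le[OF exponent_box_finite_card(1)] exponent_box_finite_card(2) order_trans by blast
  with lt have "card ((\<lambda>t. Poly_Mapping.single t (1 :: 'k)) ` exponent_box m N) < card E" by simp
  from mpoly.nontrivial_relation[OF finE span _ this] obtain c where
    c: "\<exists>a \<in> E. c a \<noteq> 0" "(\<Sum>a \<in> E. const (c a) * ?F a) = 0"
    using exponent_box_finite_card(1) by blast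
  show ?thesis
  proof (intro exI[of _ "{a \<in> E. c a \<noteq> 0}"] exI[of _ c] conjI)
    have "(\<Sum>a \<in> {a \<in> E. c a \<noteq> 0}. const (c a) * ?F a) = (\<Sum>a \<in> E. const (c a) * ?F a)"
      using finE by (intro sum.mono_neutral_left) auto
    then show "(\<Sum>a \<in> {a \<in> E. c a \<noteq> 0}. const (c a) * ?F a) = 0" using c(2) by simp
    show "{a \<in> E. c a \<noteq> 0} \<subseteq> extensional {..m}" by (auto simp: E_def PiE_iff)
  qed (use finE c(1) in auto)
qed

section \<open>Lengths of chains of primes\<close>

lemma prime_power_mult_cancel:
  fixes P :: "'k::field mpoly set"
  assumes P: "primeideal P (poly_ring m)" and "f \<in> carrier (poly_ring m)" "g \<in> carrier (poly_ring m)"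
    and "f \<notin> P" "f ^ d * g \<in> P"
  shows "g \<in> P"
  using assms(5)
proof (induction d)
  case (Suc d)
  then have "f * (f ^ d * g) \<in> P" by (simp add: mult_ac)
  then have "f ^ d * g \<in> P"
    using primeideal_poly_ringD(3)[OF P assms(2), of "f ^ d * g"] assms(2-4) by auto
  then show ?case by (rule Suc.IH)
qed simp

lemma poly_ring_sum_closed:
  assumes "\<And>i. i \<in> A \<Longrightarrow> h i \<in> carrier (poly_ring m)"
  shows "(\<Sum>i \<in> A. h i) \<in> carrier (poly_ring m)"
  using assms by (induction A rule: infinite_finite_induct) auto

lemma poly_ring_prod_closed:
  assumes "\<And>i. i \<in> A \<Longrightarrow> h i \<in> carrier (poly_ring m)"
  shows "(\<Prod>i \<in> A. h i) \<in> carrier (poly_ring m)"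
  using assms by (induction A rule: infinite_finite_induct) auto

lemma const_notin_prime:
  assumes "primeideal P (poly_ring m)" "c \<noteq> 0"
  shows "const c \<notin> P"
proof
  assume "const c \<in> P"
  then have "const (inverse c) * const c \<in> P"
    by (intro ideal_poly_ringD(4)[OF primeideal_poly_ringD(1)[OF assms(1)]]) auto
  then show False
    using primeideal_poly_ringD(2)[OF assms(1)] assms(2) by (simp add: mult_single)
qed

text \<open>Elements \<open>f\<^sub>i\<close> of \<open>c\<^sub>i\<^sub>+\<^sub>1 - c\<^sub>i\<close> are algebraically independent: in a relation between them, keep
  only the terms with the lowest power of \<open>f\<^sub>0\<close>, cancel that power modulo \<open>c\<^sub>0\<close>, and continue with
  \<open>f\<^sub>1\<close> modulo \<open>c\<^sub>1\<close>.\<close>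

lemma prime_chain_length_le:
  fixes c :: "nat \<Rightarrow> 'k::field mpoly set"
  assumes "prime_chain (poly_ring m) k c"
  shows "k \<le> m"
proof (rule ccontr)
  assume km: "\<not> k \<le> m"
  have P: "primeideal (c i) (poly_ring m)" if "i \<le> Suc m" for i
    using assms km that by (auto simp: prime_chain_def)
  note I = primeideal_poly_ringD(1)[OF P]
  have strict: "c j \<subset> c (Suc j)" if "j \<le> m" for j
    using assms km that by (auto simp: prime_chain_def)
  then have "\<forall>j. \<exists>g. j \<le> m \<longrightarrow> g \<in> c (Suc j) \<and> g \<notin> c j" by blast
  then have "\<exists>f. \<forall>j \<le> m. f j \<in> c (Suc j) \<and> f j \<notin> c j" by metis
  then obtain f where f: "\<And>j. j \<le> m \<Longrightarrow> f j \<in> c (Suc j)" "\<And>j. j \<le> m \<Longrightarrow> f j \<notin> c j" by blast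
  have fc: "f j \<in> carrier (poly_ring m)" if "j \<le> m" for j
    using ideal_poly_ringD(1)[OF I] f(1)[OF that] that by blast
  obtain A u where A: "finite A" "A \<noteq> {}" "A \<subseteq> extensional {..m}" "\<And>a. a \<in> A \<Longrightarrow> u a \<noteq> 0"
    and rel: "(\<Sum>a \<in> A. const (u a) * (\<Prod>j \<le> m. f j ^ a j)) = 0"
    using algebraically_dependent[of m f, OF fc] by blast
  let ?t = "\<lambda>i a. const (u a) * (\<Prod>j \<in> {i..m}. f j ^ a j)"
  have tc: "?t i a \<in> carrier (poly_ring m)" for i a
    by (intro poly_ring_closed poly_ring_prod_closed fc const_in_poly_ring) auto
  \<comment> \<open>After \<open>i\<close> steps the surviving exponent functions agree below
    \<open>i\<close>, the powers of \<open>f j\<close> with \<open>j < i\<close> have been removed,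
    and what remains of the relation holds modulo \<open>c i\<close>.\<close>
  have "\<exists>B \<subseteq> A. B \<noteq> {} \<and> (\<forall>a \<in> B. \<forall>b \<in> B. \<forall>j < i. a j = b j) \<and> (\<Sum>a \<in> B. ?t i a) \<in> c i"
    if "i \<le> Suc m" for i
    using that
  proof (induction i)
    case 0
    have "(\<Sum>a \<in> A. ?t 0 a) = 0"
      using rel by (simp add: atMost_atLeast0)
    then have "(\<Sum>a \<in> A. ?t 0 a) \<in> c 0" using ideal_poly_ringD(2)[OF I[of 0]] by simp
    then show ?case using A(2) by (intro exI[of _ A]) auto
  next
    case (Suc i)
    then have i: "i \<le> m" by simp
    obtain B where B: "B \<subseteq> A" "B \<noteq> {}" "\<forall>a \<in> B. \<forall>b \<in> B. \<forall>j < i. a j = b j"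
      "(\<Sum>a \<in> B. ?t i a) \<in> c i"
      using Suc.IH i by auto
    have finB: "finite B" using A(1) B(1) finite_subset by blast
    define d where "d = Min ((\<lambda>a. a i) ` B)"
    have d_le: "d \<le> a i" if "a \<in> B" for a
      using that finB by (simp add: d_def)
    have "d \<in> (\<lambda>a. a i) ` B" unfolding d_def using finB B(2) by (intro Min_in) auto
    then have ne: "{a \<in> B. a i = d} \<noteq> {}" by auto
    let ?s = "\<lambda>a. f i ^ (a i - d) * ?t (Suc i) a"
    have sc: "?s a \<in> carrier (poly_ring m)" for a
      using fc[OF i] tc by auto
    have "(\<Sum>a \<in> B. ?t i a) = (\<Sum>a \<in> B. f i ^ d * ?s a)"
    proof (rule sum.cong[OF refl])
      fix a assume "a \<in> B"
      then have "f i ^ a i = f i ^ d * f i ^ (a i - d)" using d_le by (simp flip: power_add)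
      moreover have "{i..m} = insert i {Suc i..m}" using i by auto
      ultimately show "?t i a = f i ^ d * ?s a" by (simp add: mult_ac)
    qed
    then have "f i ^ d * (\<Sum>a \<in> B. ?s a) \<in> c i" using B(4) by (simp add: sum_distrib_left)
    then have "(\<Sum>a \<in> B. ?s a) \<in> c i"
      by (rule prime_power_mult_cancel[OF P fc[OF i] poly_ring_sum_closed[OF sc] f(2)[OF i], rotated])
        (use i in simp)
    moreover have "c i \<subseteq> c (Suc i)" using strict[OF i] by blast
    ultimately have 1: "(\<Sum>a \<in> B. ?s a) \<in> c (Suc i)" by blast
    \<comment> \<open>A term with more than the lowest power of \<open>f i\<close> keeps a factor
      \<open>f i\<close> after the cancellation, and this factor lies in
      \<open>c (Suc i)\<close>.\<close>
    have 2: "(\<Sum>a \<in> {a \<in> B. a i \<noteq> d}. ?s a) \<in> c (Suc i)"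
    proof (rule ideal_sum_closed[OF I])
      fix a assume a: "a \<in> {a \<in> B. a i \<noteq> d}"
      then obtain e where "a i - d = Suc e" using d_le[of a] by (cases "a i - d") auto
      then have "?s a = f i * (f i ^ e * ?t (Suc i) a)"
        by (simp only: power_Suc mult.assoc)
      also have "\<dots> \<in> c (Suc i)"
        using fc[OF i] tc f(1)[OF i] Suc.prems by (intro ideal_poly_ringD(5)[OF I]) auto
      finally show "?s a \<in> c (Suc i)" .
    qed (use Suc.prems in auto)
    have "(\<Sum>a \<in> B. ?s a) = (\<Sum>a \<in> {a \<in> B. a i = d}. ?s a) + (\<Sum>a \<in> {a \<in> B. a i \<noteq> d}. ?s a)"
      using finB by (subst sum.union_disjoint[symmetric]) (auto intro!: sum.cong)
    then have "(\<Sum>a \<in> {a \<in> B. a i = d}. ?s a) \<in> c (Suc i)"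
      using ideal_poly_ring_sub[OF I 1 2] Suc.prems by simp
    then have "(\<Sum>a \<in> {a \<in> B. a i = d}. ?t (Suc i) a) \<in> c (Suc i)" by simp
    then show ?case
      using B(1,3) ne by (intro exI[of _ "{a \<in> B. a i = d}"]) (auto simp: less_Suc_eq)
  qed
  from this[OF le_refl] obtain B where B: "B \<subseteq> A" "B \<noteq> {}"
    "\<forall>a \<in> B. \<forall>b \<in> B. \<forall>j < Suc m. a j = b j" "(\<Sum>a \<in> B. ?t (Suc m) a) \<in> c (Suc m)"
    by blast
  obtain a where a: "a \<in> B" using B(2) by blast
  \<comment> \<open>All exponents on \<open>{..m}\<close> agree now, so a single term is left, and
    it is a nonzero constant lying in a prime.\<close>
  have "b = a" if "b \<in> B" for b
    using that a A(3) B(1,3) by (intro extensionalityI[of _ "{..m}"]) auto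
  then have "B = {a}" using a by blast
  then have "const (u a) \<in> c (Suc m)" using B(4) by simp
  then show False using const_notin_prime[OF P] A(4) B(1) a by blast
qed

text \<open>A chain that ends in \<open>d 0\<close> can be continued by \<open>d\<close>, and the
  joint chain has length at most \<open>m\<close>.\<close>

lemma prime_height_le:
  fixes d :: "nat \<Rightarrow> 'k::field mpoly set"
  assumes "prime_chain (poly_ring m) j d"
  shows "prime_height (poly_ring m) (d 0) \<le> enat (m - j)"
  unfolding prime_height_prime_chain
proof (rule Sup_least)
  fix x assume "x \<in> {enat k | k. \<exists>c. prime_chain (poly_ring m) k c \<and> c k = d 0}"
  then obtain k c where x: "x = enat k" and c: "prime_chain (poly_ring m) k c" "c k = d 0" by blast
  have "k + j \<le> m"
    using prime_chain_length_le[OF prime_chain_append[OF c(1) assms]] c(2) by simp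
  then show "x \<le> enat (m - j)" by (simp add: x)
qed

abbreviation kill :: "nat set \<Rightarrow> 'k::field mpoly \<Rightarrow> 'k mpoly" where
  "kill W \<equiv> subst_mpoly (\<lambda>i. if i \<in> W then 0 else var i)"

lemma kill_kill: "kill W (kill V f) = kill (V \<union> W) (f :: 'k::field mpoly)"
proof -
  have "(\<lambda>i. kill W (if i \<in> V then 0 else var i)) = (\<lambda>i. if i \<in> V \<union> W then 0 else var i :: 'k mpoly)"
    by auto
  then show ?thesis by (simp only: subst_subst)
qed

lemma subst_var [simp]: "subst_mpoly var f = f"
  by (induction f rule: mpoly_induct) simp_all

text \<open>Killing the parameters listed in \<open>ws\<close> one after another yields an ascending
  chain of kernels. Each entry of \<open>ws\<close> names both the parameter that is killed and a
  coordinate that newly enters the kernel, which makes the step strict.\<close>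

lemma prime_height_subst_kernel_le:
  fixes q :: "nat \<Rightarrow> 'k::field mpoly"
  assumes "\<And>i. i < length ws \<Longrightarrow> ws ! i \<in> {1..m} \<and> kill (set (take i ws)) (q (ws ! i)) \<noteq> 0 \<and>
    kill (set (take (Suc i) ws)) (q (ws ! i)) = 0"
  shows "prime_height (poly_ring m) (subst_kernel m q) \<le> enat (m - length ws)"
proof -
  let ?d = "\<lambda>i. subst_kernel m (\<lambda>v. kill (set (take i ws)) (q v))"
  have "prime_chain (poly_ring m) (length ws) ?d"
    unfolding prime_chain_def
  proof (intro conjI allI impI psubsetI)
    fix i assume i: "i < length ws"
    have "kill (set (take (Suc i) ws)) g = kill {ws ! i} (kill (set (take i ws)) g)" for g :: "'k mpoly"
      using i unfolding kill_kill by (simp add: take_Suc_conv_app_nth)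
    then have "subst_mpoly (\<lambda>v. kill (set (take (Suc i) ws)) (q v)) f =
        kill {ws ! i} (subst_mpoly (\<lambda>v. kill (set (take i ws)) (q v)) f)" for f
      by (simp only: subst_subst)
    then show "?d i \<subseteq> ?d (Suc i)"
      by (auto simp: subst_kernel_def)
    show "?d i \<noteq> ?d (Suc i)"
      using assms[OF i] var_in_poly_ring[of "ws ! i" m]
      by (auto simp: subst_kernel_def set_eq_iff intro!: exI[of _ "var (ws ! i)"])
  qed (rule primeideal_subst_kernel)
  from prime_height_le[OF this] show ?thesis by simp
qed


section \<open>Generators of equigenerated homogeneous ideals\<close>

lemma genideal_poly_ring:
  fixes A :: "'k::field mpoly set"
  assumes "A \<subseteq> carrier (poly_ring m)"
  shows "ideal (genideal (poly_ring m) A) (poly_ring m)" "A \<subseteq> genideal (poly_ring m) A"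
    "ideal I (poly_ring m) \<Longrightarrow> A \<subseteq> I \<Longrightarrow> genideal (poly_ring m) A \<subseteq> I"
proof -
  interpret cring "poly_ring m :: 'k mpoly ring" by (rule cring_poly_ring)
  show "ideal (genideal (poly_ring m) A) (poly_ring m)" by (rule genideal_ideal[OF assms])
  show "A \<subseteq> genideal (poly_ring m) A" by (rule genideal_self[OF assms])
  show "ideal I (poly_ring m) \<Longrightarrow> A \<subseteq> I \<Longrightarrow> genideal (poly_ring m) A \<subseteq> I"
    by (rule genideal_minimal)
qed

lemma span_subset_ideal:
  fixes I :: "'k::field mpoly set"
  assumes "ideal I (poly_ring m)" "A \<subseteq> I"
  shows "mpoly.span A \<subseteq> I"
  by (rule mpoly.span_minimal[OF assms(2)])
    (auto simp: mpoly.subspace_def intro: ideal_poly_ringD[OF assms(1)])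

section \<open>Graded pieces and minimal generators\<close>

lemma monomial_degree_superset:
  assumes "finite A" "Poly_Mapping.keys t \<subseteq> A"
  shows "monomial_degree t = (\<Sum>i \<in> A. Poly_Mapping.lookup t i)"
  unfolding monomial_degree_def using assms
  by (intro sum.mono_neutral_left) (auto simp: in_keys_iff)

lemma monomial_degree_add: "monomial_degree (s + t) = monomial_degree s + monomial_degree t"
proof -
  let ?A = "Poly_Mapping.keys s \<union> Poly_Mapping.keys t"
  have "Poly_Mapping.keys (s + t) \<subseteq> ?A" by (rule Poly_Mapping.keys_add)
  then show ?thesis
    by (simp add: monomial_degree_superset[of ?A] lookup_add sum.distrib)
qed

lemma monomial_degree_eq_0_iff: "monomial_degree t = 0 \<longleftrightarrow> t = 0"
  by (auto simp: monomial_degree_def in_keys_iff intro!: poly_mapping_eqI)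

definition deg_part_eq :: "nat \<Rightarrow> 'k::field mpoly set" where
  "deg_part_eq d = {p. \<forall>t \<in> Poly_Mapping.keys p. monomial_degree t = d}"

definition deg_part_gt :: "nat \<Rightarrow> 'k::field mpoly set" where
  "deg_part_gt d = {p. \<forall>t \<in> Poly_Mapping.keys p. d < monomial_degree t}"

lemma deg_part_gt_mult:
  assumes "p \<in> deg_part_gt d"
  shows "r * p \<in> deg_part_gt d"
  unfolding deg_part_gt_def
proof (intro CollectI ballI)
  fix t assume "t \<in> Poly_Mapping.keys (r * p)"
  then obtain a b where "t = a + b" "b \<in> Poly_Mapping.keys p"
    using Poly_Mapping.keys_mult[of r p] by blast
  then show "d < monomial_degree t"
    using assms by (auto simp: deg_part_gt_def monomial_degree_add trans_less_add2)
qed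

lemma deg_part_gt_add:
  "p \<in> deg_part_gt d \<Longrightarrow> q \<in> deg_part_gt d \<Longrightarrow> p + q \<in> deg_part_gt d"
  using Poly_Mapping.keys_add[of p q] by (auto simp: deg_part_gt_def)

text \<open>Without its constant term, \<open>r\<close> has only monomials of positive degree, each
  of which raises the degree.\<close>

lemma deg_part_gt_mult_eq:
  assumes "s \<in> deg_part_eq d"
  shows "(r - const (Poly_Mapping.lookup r 0)) * s \<in> deg_part_gt d"
  unfolding deg_part_gt_def
proof (intro CollectI ballI)
  fix t assume "t \<in> Poly_Mapping.keys ((r - const (Poly_Mapping.lookup r 0)) * s)"
  then obtain a b where t: "t = a + b" "a \<in> Poly_Mapping.keys (r - const (Poly_Mapping.lookup r 0))"
    "b \<in> Poly_Mapping.keys s"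
    using Poly_Mapping.keys_mult by blast
  then have "a \<noteq> 0" by (auto simp: in_keys_iff lookup_minus)
  then have "0 < monomial_degree a" by (metis gr0I monomial_degree_eq_0_iff)
  then show "d < monomial_degree t"
    using assms t by (auto simp: deg_part_eq_def monomial_degree_add)
qed

lemma subspace_deg_part_eq: "mpoly.subspace (deg_part_eq d :: 'k::field mpoly set)"
  unfolding mpoly.subspace_def
proof (intro conjI ballI allI)
  show "0 \<in> deg_part_eq d" by (simp add: deg_part_eq_def)
  show "p + q \<in> deg_part_eq d" if "p \<in> deg_part_eq d" "q \<in> deg_part_eq d" for p q :: "'k mpoly"
    using that Poly_Mapping.keys_add[of p q] by (auto simp: deg_part_eq_def)
  show "const c * p \<in> deg_part_eq d" if "p \<in> deg_part_eq d" for c and p :: "'k mpoly"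
    using that Poly_Mapping.keys_mult[of "const c" p]
    by (auto simp: deg_part_eq_def split: if_splits)
qed

lemma span_deg_part_eq: "A \<subseteq> deg_part_eq d \<Longrightarrow> mpoly.span A \<subseteq> deg_part_eq d"
  by (rule mpoly.span_minimal[OF _ subspace_deg_part_eq])

lemma deg_parts_disjoint: "p \<in> deg_part_eq d \<Longrightarrow> p \<in> deg_part_gt d \<Longrightarrow> p = 0"
  by (auto simp: deg_part_eq_def deg_part_gt_def)

text \<open>Modulo degrees above \<open>d\<close>, multiplying by \<open>r\<close> amounts to
  multiplying by its constant term. In the lowest degree, the ideal is therefore just the linear
  span of the generators of that degree.\<close>

lemma genideal_lowest_part:
  fixes A :: "'k::field mpoly set"
  assumes A: "A \<subseteq> carrier (poly_ring m)" "A \<subseteq> deg_part_eq d \<union> deg_part_gt d"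
    and f: "f \<in> genideal (poly_ring m) A"
  obtains s where "s \<in> mpoly.span (A \<inter> deg_part_eq d)" "f - s \<in> deg_part_gt d"
proof -
  let ?S = "mpoly.span (A \<inter> deg_part_eq d)"
  \<comment> \<open>The polynomials with the desired decomposition; they are shown to form an ideal
    that contains \<open>A\<close>.\<close>
  define J where "J = {f \<in> carrier (poly_ring m). \<exists>s \<in> ?S. f - s \<in> deg_part_gt d}"
  have zero: "0 \<in> deg_part_gt d" by (simp add: deg_part_gt_def)
  have "ideal J (poly_ring m)"
  proof (rule ideal_poly_ringI)
    show "J \<subseteq> carrier (poly_ring m)" by (auto simp: J_def)
    show "0 \<in> J" using zero by (auto simp: J_def intro!: bexI[of _ 0] mpoly.span_zero)
  next
    fix f g assume "f \<in> J" "g \<in> J"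
    then obtain s t where st: "s \<in> ?S" "t \<in> ?S" "f - s \<in> deg_part_gt d" "g - t \<in> deg_part_gt d"
      "f \<in> carrier (poly_ring m)" "g \<in> carrier (poly_ring m)" by (auto simp: J_def)
    have "f + g - (s + t) = (f - s) + (g - t)" by simp
    then have "f + g - (s + t) \<in> deg_part_gt d" using st deg_part_gt_add by metis
    then show "f + g \<in> J" using st mpoly.span_add[OF st(1,2)] by (auto simp: J_def)
  next
    fix f r :: "'k mpoly" assume "f \<in> J" and r: "r \<in> carrier (poly_ring m)"
    then obtain s where s: "s \<in> ?S" "f - s \<in> deg_part_gt d" "f \<in> carrier (poly_ring m)"
      by (auto simp: J_def)
    let ?c = "const (Poly_Mapping.lookup r 0)"
    have "s \<in> deg_part_eq d" using s(1) span_deg_part_eq by blast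
    then have "(r - ?c) * s + r * (f - s) \<in> deg_part_gt d"
      using s(2) by (intro deg_part_gt_add deg_part_gt_mult deg_part_gt_mult_eq)
    moreover have "(r - ?c) * s + r * (f - s) = r * f - ?c * s" by (simp add: algebra_simps)
    moreover have "?c * s \<in> ?S" by (rule mpoly.span_scale[OF s(1)])
    ultimately show "r * f \<in> J" using r s(3) by (auto simp: J_def)
  qed
  moreover have "A \<subseteq> J"
  proof
    fix a assume a: "a \<in> A"
    with A(2) consider "a \<in> deg_part_eq d" | "a \<in> deg_part_gt d" by blast
    then have "\<exists>s \<in> ?S. a - s \<in> deg_part_gt d"
    proof cases
      case 1
      then show ?thesis using a zero by (intro bexI[of _ a] mpoly.span_base) auto
    next
      case 2
      then show ?thesis by (intro bexI[of _ 0] mpoly.span_zero) auto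
    qed
    then show "a \<in> J" using a A(1) by (auto simp: J_def)
  qed
  ultimately have "f \<in> J" using genideal_poly_ring(3)[OF A(1)] f by blast
  then show ?thesis using that by (auto simp: J_def)
qed

lemma genideal_deg_part_eq:
  fixes A :: "'k::field mpoly set"
  assumes "A \<subseteq> carrier (poly_ring m)" "A \<subseteq> deg_part_eq d \<union> deg_part_gt d"
    and "f \<in> genideal (poly_ring m) A" "f \<in> deg_part_eq d"
  shows "f \<in> mpoly.span (A \<inter> deg_part_eq d)"
proof -
  obtain s where s: "s \<in> mpoly.span (A \<inter> deg_part_eq d)" "f - s \<in> deg_part_gt d"
    using genideal_lowest_part[OF assms(1-3)] .
  then have "s \<in> deg_part_eq d" using span_deg_part_eq by blast
  then have "f - s \<in> deg_part_eq d"
    by (rule mpoly.subspace_diff[OF subspace_deg_part_eq assms(4)])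
  then have "f - s = 0" using s(2) deg_parts_disjoint by blast
  then show ?thesis using s(1) by simp
qed

text \<open>A generator that is a linear combination of the others also lies in the ideal that they
  generate, against minimality.\<close>

lemma minimal_generators_independent:
  fixes A :: "'k::field mpoly set"
  assumes "minimal_homogeneous_generators m I A"
  shows "mpoly.independent A"
proof
  have A: "A \<subseteq> carrier (poly_ring m)" "genideal (poly_ring m) A = I"
    "\<And>B. B \<subset> A \<Longrightarrow> genideal (poly_ring m) B \<noteq> I"
    using assms by (auto simp: minimal_homogeneous_generators_def)
  assume "mpoly.dependent A"
  then obtain a where a: "a \<in> A" "a \<in> mpoly.span (A - {a})"
    by (auto simp: mpoly.dependent_def)
  let ?J = "genideal (poly_ring m) (A - {a})"
  have sub: "A - {a} \<subseteq> carrier (poly_ring m)" using A(1) by blast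
  have "mpoly.span (A - {a}) \<subseteq> ?J"
    by (rule span_subset_ideal[OF genideal_poly_ring(1,2)[OF sub]])
  then have "A \<subseteq> ?J" using a genideal_poly_ring(2)[OF sub] by blast
  then have "I \<subseteq> ?J" using genideal_poly_ring(3)[OF A(1) genideal_poly_ring(1)[OF sub]] A(2) by blast
  moreover have "A - {a} \<subseteq> I" using genideal_poly_ring(2)[OF A(1)] A(2) by blast
  then have "?J \<subseteq> I"
    using genideal_poly_ring(3)[OF sub] genideal_poly_ring(1)[OF A(1)] A(2) by blast
  ultimately show False using A(3)[of "A - {a}"] a(1) by blast
qed

text \<open>Every minimal homogeneous generating set is a basis of the linear span of
  \<open>G\<close>, so the choice made in \<open>num_generators\<close> does not affect the
  cardinality.\<close>

lemma num_generators_eq_card: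
  fixes G :: "'k::field mpoly set"
  assumes G: "G \<subseteq> carrier (poly_ring m)" "finite G" "mpoly.independent G" "G \<subseteq> deg_part_eq d"
  shows "num_generators m (genideal (poly_ring m) G) = card G"
proof -
  let ?I = "genideal (poly_ring m) G"
  have GI: "G \<subseteq> ?I" by (rule genideal_poly_ring(2)[OF G(1)])
  have "minimal_homogeneous_generators m ?I G"
    unfolding minimal_homogeneous_generators_def
  proof (intro conjI allI impI ballI notI)
    show "homogeneous p" if "p \<in> G" for p
      using that G(4) by (auto simp: homogeneous_def deg_part_eq_def)
    fix B assume B: "B \<subset> G" and eq: "genideal (poly_ring m) B = ?I"
    then obtain g where g: "g \<in> G" "g \<notin> B" by blast
    then have "g \<in> mpoly.span (B \<inter> deg_part_eq d)"
      using B G GI eq by (intro genideal_deg_part_eq[of B m]) auto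
    also have "\<dots> \<subseteq> mpoly.span (G - {g})"
      using B g by (intro mpoly.span_mono) auto
    finally show False using G(3) g(1) by (auto simp: mpoly.dependent_def)
  qed (use G in auto)
  moreover have "card A = card G" if A: "minimal_homogeneous_generators m ?I A" for A
  proof -
    have A1: "A \<subseteq> carrier (poly_ring m)" "genideal (poly_ring m) A = ?I"
      "\<And>B. B \<subset> A \<Longrightarrow> genideal (poly_ring m) B \<noteq> ?I" "\<And>a. a \<in> A \<Longrightarrow> homogeneous a"
      using A by (auto simp: minimal_homogeneous_generators_def)
    have AI: "A \<subseteq> ?I" using genideal_poly_ring(2)[OF A1(1)] A1(2) by blast
    \<comment> \<open>An element of an ideal generated in degree \<open>d\<close> has no term below
      degree \<open>d\<close>; a homogeneous one therefore lies in one of the two parts.\<close>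
    have parts: "A \<subseteq> deg_part_eq d \<union> deg_part_gt d"
    proof
      fix a assume a: "a \<in> A"
      obtain e where e: "\<And>t. t \<in> Poly_Mapping.keys a \<Longrightarrow> monomial_degree t = e"
        using A1(4)[OF a] by (auto simp: homogeneous_def)
      obtain s where s: "s \<in> mpoly.span (G \<inter> deg_part_eq d)" "a - s \<in> deg_part_gt d"
        using genideal_lowest_part[OF G(1), of d a] G(4) a AI by blast
      have "s \<in> deg_part_eq d" using s(1) span_deg_part_eq by blast
      then have "\<And>t. t \<in> Poly_Mapping.keys a \<Longrightarrow> d \<le> monomial_degree t"
        using s(2) Poly_Mapping.keys_add[of s "a - s"]
        by (fastforce simp: deg_part_eq_def deg_part_gt_def)
      then show "a \<in> deg_part_eq d \<union> deg_part_gt d"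
        using e by (cases "e = d") (fastforce simp: deg_part_eq_def deg_part_gt_def)+
    qed
    let ?B = "A \<inter> deg_part_eq d"
    have sub: "?B \<subseteq> carrier (poly_ring m)" using A1(1) by blast
    have GB: "G \<subseteq> mpoly.span ?B"
      using genideal_deg_part_eq[OF A1(1) parts] A1(2) GI G(4) by blast
    also have "\<dots> \<subseteq> genideal (poly_ring m) ?B"
      by (rule span_subset_ideal[OF genideal_poly_ring(1,2)[OF sub]])
    finally have "?I \<subseteq> genideal (poly_ring m) ?B"
      by (rule genideal_poly_ring(3)[OF G(1) genideal_poly_ring(1)[OF sub]])
    moreover have "genideal (poly_ring m) ?B \<subseteq> ?I"
      by (rule genideal_poly_ring(3)[OF sub genideal_poly_ring(1)[OF G(1)]]) (use AI in blast)
    \<comment> \<open>The generators of degree \<open>d\<close> alone yield the ideal, so minimality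
      leaves no others.\<close>
    ultimately have "?B = A" using A1(3)[of ?B] by blast
    then have "G \<subseteq> mpoly.span A" "A \<subseteq> deg_part_eq d" using GB by auto
    moreover have "A \<subseteq> mpoly.span G"
    proof
      fix a assume "a \<in> A"
      then have "a \<in> mpoly.span (G \<inter> deg_part_eq d)"
        using \<open>A \<subseteq> deg_part_eq d\<close> AI G(1,4) by (intro genideal_deg_part_eq[of G m]) auto
      then show "a \<in> mpoly.span G" using mpoly.span_mono[of "G \<inter> deg_part_eq d" G] by blast
    qed
    ultimately show ?thesis
      using mpoly.independent_span_bound[OF G(2) minimal_generators_independent[OF A]]
        mpoly.independent_span_bound[OF _ G(3), of A] by (meson antisym)
  qed
  ultimately show ?thesis
    unfolding num_generators_def by (metis (mono_tags, lifting) someI_ex)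
qed


section \<open>Hankel minors\<close>

lemma var_mult_var:
  "var a * var b = Poly_Mapping.single (Poly_Mapping.single a 1 + Poly_Mapping.single b 1) (1 :: 'k::field)"
  by (simp add: var_def mult_single)

lemma quadratic_monomial_eq_iff:
  "Poly_Mapping.single a 1 + Poly_Mapping.single b (1 :: nat) =
   Poly_Mapping.single c 1 + Poly_Mapping.single d 1 \<longleftrightarrow> a = c \<and> b = d \<or> a = d \<and> b = c"
  (is "?s = ?t \<longleftrightarrow> _")
proof
  assume eq: "?s = ?t"
  have "Poly_Mapping.lookup ?s x = Poly_Mapping.lookup ?t x" for x by (simp only: eq)
  from this[of a] this[of b] this[of c] this[of d] show "a = c \<and> b = d \<or> a = d \<and> b = c"
    by (simp add: lookup_add lookup_single when_def split: if_splits)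
qed (auto simp: add.commute)

lemma lookup_hankel_minor:
  "Poly_Mapping.lookup (hankel_minor i j :: 'k::field mpoly)
     (Poly_Mapping.single a 1 + Poly_Mapping.single b 1) =
   (if i = a \<and> j + 1 = b \<or> i = b \<and> j + 1 = a then 1 else 0) -
   (if j = a \<and> i + 1 = b \<or> j = b \<and> i + 1 = a then 1 else 0)"
  by (simp add: hankel_minor_def var_mult_var lookup_minus lookup_single when_def
      quadratic_monomial_eq_iff del: One_nat_def)

lemma hankel_minor_in_poly_ring:
  "1 \<le> i \<Longrightarrow> i < j \<Longrightarrow> j < m \<Longrightarrow> hankel_minor i j \<in> carrier (poly_ring m)"
  by (auto simp: hankel_minor_def intro!: poly_ring_closed var_in_poly_ring)

lemma hankel_minor_deg: "hankel_minor i j \<in> deg_part_eq 2"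
proof -
  have "var a * var b \<in> deg_part_eq 2" for a b :: nat
    by (simp add: var_mult_var deg_part_eq_def monomial_degree_add)
      (simp add: monomial_degree_def)
  then show ?thesis
    unfolding hankel_minor_def by (intro mpoly.subspace_diff[OF subspace_deg_part_eq])
qed

text \<open>The monomial \<open>x\<^sub>i x\<^sub>j\<^sub>+\<^sub>1\<close> occurs in \<open>g\<^sub>i\<^sub>j\<close>, and otherwise only in \<open>g\<^sub>i\<^sub>-\<^sub>1\<^sub>,\<^sub>j\<^sub>+\<^sub>1\<close>, whose index gap is larger.\<close>

lemma independent_hankel_minors:
  fixes E :: "(nat \<times> nat) set"
  assumes "finite E" "\<And>i j. (i, j) \<in> E \<Longrightarrow> i < j"
  shows "inj_on (\<lambda>(i, j). hankel_minor i j :: 'k::field mpoly) E \<and>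
    mpoly.independent ((\<lambda>(i, j). hankel_minor i j :: 'k mpoly) ` E)"
  using assms
\<comment> \<open>Pairs are added in the order of their gaps \<open>j - i\<close>. The minor of the
  new pair therefore has a monomial \<open>?t\<close> on which all earlier minors, and so their
  span, have coefficient 0.\<close>
proof (induction rule: finite_ranking_induct[where f = "\<lambda>(i, j). j - i"])
  case empty
  then show ?case by (simp add: mpoly.independent_empty)
next
  case (insert e E)
  let ?g = "\<lambda>(i, j). hankel_minor i j :: 'k mpoly"
  show ?case
  proof (cases "e \<in> E")
    case True
    then show ?thesis using insert by (simp add: insert_absorb)
  next
    case False
    obtain i j where e: "e = (i, j)" by (cases e)
    let ?t = "Poly_Mapping.single i 1 + Poly_Mapping.single (j + 1) 1 :: nat \<Rightarrow>\<^sub>0 nat"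
    let ?V = "{p :: 'k mpoly. Poly_Mapping.lookup p ?t = 0}"
    have sub: "mpoly.subspace ?V"
      unfolding mpoly.subspace_def by (auto simp: lookup_add simp flip: mult_map_scale_conv_mult)
        (simp add: map.rep_eq when_def)
    have "?g ` E \<subseteq> ?V"
    proof (clarify)
      fix a b assume ab: "(a, b) \<in> E"
      then have "b - a \<le> j - i" "a < b" "i < j" "(a, b) \<noteq> (i, j)"
        using insert.hyps(2)[OF ab] insert.prems e False by auto
      then show "Poly_Mapping.lookup (hankel_minor a b :: 'k mpoly) ?t = 0"
        unfolding lookup_hankel_minor by auto
    qed
    then have "mpoly.span (?g ` E) \<subseteq> ?V" by (rule mpoly.span_minimal[OF _ sub])
    moreover have "?g e \<notin> ?V"
      using insert.prems[of i j] e lookup_hankel_minor[where 'k = 'k, of i j i "j + 1"] by auto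
    ultimately have "?g e \<notin> mpoly.span (?g ` E)" by blast
    moreover from this have "?g e \<notin> ?g ` E" using mpoly.span_base by blast
    ultimately show ?thesis
      using insert False by (auto simp: mpoly.independent_insert)
  qed
qed

lemma num_generators_hankel:
  assumes "finite E" "\<And>i j. (i, j) \<in> E \<Longrightarrow> 1 \<le> i \<and> i < j \<and> j < m"
  shows "num_generators m (genideal (poly_ring m)
    ((\<lambda>(i, j). hankel_minor i j :: 'k::field mpoly) ` E)) = card E"
proof -
  have ind: "inj_on (\<lambda>(i, j). hankel_minor i j :: 'k mpoly) E"
      "mpoly.independent ((\<lambda>(i, j). hankel_minor i j :: 'k mpoly) ` E)"
    using independent_hankel_minors[of E] assms by auto
  have "num_generators m (genideal (poly_ring m)
      ((\<lambda>(i, j). hankel_minor i j :: 'k mpoly) ` E)) =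
    card ((\<lambda>(i, j). hankel_minor i j :: 'k mpoly) ` E)"
    using assms ind(2) hankel_minor_deg
    by (intro num_generators_eq_card[where d = 2]) (auto intro: hankel_minor_in_poly_ring)
  then show ?thesis using card_image[OF ind(1)] by simp
qed


section \<open>Height of the ideal of a breadth-first labelled path\<close>

text \<open>In a breadth-first labelling of a path, the vertices alternate between the two sides of the
  root until, after label \<open>h\<close>, only one side is left (\<open>h = 2\<close> if the root is an end).\<close>

definition bfs_parent :: "nat \<Rightarrow> nat \<Rightarrow> nat" where
  "bfs_parent h k = (if k = 2 \<or> h < k then k - 1 else k - 2)"

definition bfs_path_edges :: "nat \<Rightarrow> nat \<Rightarrow> (nat \<times> nat) set" where
  "bfs_path_edges h n = (\<lambda>k. (bfs_parent h k, k)) ` {2..n}"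

definition minors_ideal :: "nat \<Rightarrow> (nat \<times> nat) set \<Rightarrow> 'k::field mpoly set" where
  "minors_ideal m E = genideal (poly_ring m) ((\<lambda>(i, j). hankel_minor i j) ` E)"

lemma bfs_path_edges_less: "(i, j) \<in> bfs_path_edges h n \<Longrightarrow> 1 \<le> i \<and> i < j \<and> j < n + 1"
  by (auto simp: bfs_path_edges_def bfs_parent_def split: if_splits)

lemma card_bfs_path_edges: "card (bfs_path_edges h n) = n - 1"
proof -
  have "inj_on (\<lambda>k. (bfs_parent h k, k)) {2..n}" by (auto simp: inj_on_def)
  then show ?thesis by (simp add: bfs_path_edges_def card_image)
qed

lemma num_generators_bfs_path:
  "num_generators (n + 1) (minors_ideal (n + 1) (bfs_path_edges h n) :: 'k::field mpoly set) = n - 1"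
proof -
  have "finite (bfs_path_edges h n)" by (simp add: bfs_path_edges_def)
  from num_generators_hankel[where 'k = 'k, OF this bfs_path_edges_less] show ?thesis
    by (simp add: minors_ideal_def card_bfs_path_edges)
qed

lemma minors_ideal_subset_iff:
  assumes "\<And>i j. (i, j) \<in> E \<Longrightarrow> 1 \<le> i \<and> i < j \<and> j < m" "ideal I (poly_ring m)"
  shows "(minors_ideal m E :: 'k::field mpoly set) \<subseteq> I \<longleftrightarrow> (\<forall>(i, j) \<in> E. hankel_minor i j \<in> I)"
proof -
  have sub: "(\<lambda>(i, j). hankel_minor i j :: 'k mpoly) ` E \<subseteq> carrier (poly_ring m)"
    using assms(1) by (auto intro: hankel_minor_in_poly_ring)
  show ?thesis
    unfolding minors_ideal_def
    using genideal_poly_ring(2)[OF sub] genideal_poly_ring(3)[OF sub assms(2)] by fastforce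
qed

section \<open>Variables modulo a prime that contains Hankel minors\<close>

locale prime_poly_ideal =
  fixes m :: nat and P :: "'k::field mpoly set"
  assumes prime: "primeideal P (poly_ring m)"
begin

lemmas ideal = primeideal_poly_ringD(1)[OF prime]

lemma var_mult_var_mem:
  assumes "1 \<le> i" "i \<le> m" "1 \<le> j" "j \<le> m"
  shows "var i * var j \<in> P \<longleftrightarrow> var i \<in> P \<or> var j \<in> P"
  using primeideal_poly_ringD(3)[OF prime, of "var i" "var j"] assms
    ideal_poly_ringD(4,5)[OF ideal] var_in_poly_ring[of i m] var_in_poly_ring[of j m] by blast

lemma diff_mem_iff:
  assumes "f - g \<in> P" shows "f \<in> P \<longleftrightarrow> g \<in> P"
  using ideal_poly_ring_sub[OF ideal, of f "f - g"] ideal_poly_ringD(3)[OF ideal assms, of g] assms by auto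

text \<open>Both products of the minor lie in \<open>P\<close> or neither does; primality turns this
  into a condition on single variables, the source of the case distinctions below.\<close>

lemma hankel_minor_mem:
  assumes "hankel_minor i j \<in> P" "1 \<le> i" "i < j" "j < m"
  shows "var i \<in> P \<or> var (j + 1) \<in> P \<longleftrightarrow> var j \<in> P \<or> var (i + 1) \<in> P"
proof -
  have "var i * var (j + 1) \<in> P \<longleftrightarrow> var j * var (i + 1) \<in> P"
    by (rule diff_mem_iff) (use assms(1) in \<open>simp add: hankel_minor_def\<close>)
  then show ?thesis using assms by (simp add: var_mult_var_mem)
qed

text \<open>The condition that \<open>prime_height_ge_triangular\<close> imposes on one variable:
  modulo \<open>P\<close>, \<open>var v\<close> is a quotient of polynomials in earlier
  variables.\<close>

definition removable :: "nat \<Rightarrow> bool" where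
  "removable v \<longleftrightarrow> (\<exists>a \<in> carrier (poly_ring (v - 1)). \<exists>b \<in> carrier (poly_ring (v - 1)).
     a \<notin> P \<and> a * var v + b \<in> P)"

lemma removable_var: "var v \<in> P \<Longrightarrow> removable v"
  unfolding removable_def using primeideal_poly_ringD(2)[OF prime]
  by (intro bexI[of _ 1] bexI[of _ 0]) auto

lemma removable_minor:
  assumes "hankel_minor i j \<in> P" "1 \<le> i" "i < j" "var i \<notin> P"
  shows "removable (Suc j)"
  unfolding removable_def
proof (intro bexI conjI)
  show "var i * var (Suc j) + - (var j * var (i + 1)) \<in> P"
    using assms(1) by (simp add: hankel_minor_def)
qed (use assms in \<open>auto intro!: poly_ring_closed var_in_poly_ring\<close>)

lemma height_ge_card:
  assumes "W \<subseteq> {1..m}" "\<And>v. v \<in> W \<Longrightarrow> removable v"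
  shows "enat (card W) \<le> prime_height (poly_ring m) P"
  by (rule prime_height_ge_triangular[OF assms(1) prime]) (use assms(2) in \<open>auto simp: removable_def\<close>)

text \<open>By each minor, \<open>var (i + 1)\<close> is in \<open>P\<close> iff
  \<open>var i\<close> or \<open>var (i + 2)\<close> is. So a variable in \<open>P\<close> forces
  every adjacent variable of index strictly between \<open>a\<close> and \<open>n + 1\<close>, and
  this spreads in both directions.\<close>

lemma consecutive_minors:
  assumes minors: "\<And>i. a \<le> i \<Longrightarrow> i < n \<Longrightarrow> hankel_minor i (i + 1) \<in> P" and a: "1 \<le> a"
    and m: "m = n + 1"
  shows "(\<forall>i \<in> {a<..n}. var i \<in> P) \<or> (\<forall>i \<in> {a..n + 1}. var i \<notin> P)"
proof (rule disjCI)
  have mem: "var i \<in> P \<or> var (i + 2) \<in> P \<longleftrightarrow> var (i + 1) \<in> P" if "a \<le> i" "i < n" for i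
    using hankel_minor_mem[OF minors[OF that]] that a m by simp
  assume "\<not> (\<forall>i \<in> {a..n + 1}. var i \<notin> P)"
  then obtain k where k: "a \<le> k" "k \<le> n + 1" "var k \<in> P" by auto
  have up: "k \<le> i \<Longrightarrow> i \<le> n \<Longrightarrow> var i \<in> P" for i
  proof (induction i rule: dec_induct)
    case (step i)
    then show ?case using mem[of i] k by auto
  qed (use k in simp)
  have down: "i \<le> k \<Longrightarrow> a < i \<Longrightarrow> var i \<in> P" for i
  proof (induction i rule: inc_induct)
    case (step i)
    then show ?case using mem[of "i - 1"] k by auto
  qed (use k in simp)
  show "\<forall>i \<in> {a<..n}. var i \<in> P" using up down by (metis greaterThanAtMost_iff nat_le_linear)
qed

end

text \<open>Each case names a set \<open>W\<close> of removable variables that omits exactly two of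
  the \<open>n + 1\<close> variables. A variable in \<open>P\<close> is removable at once; one
  outside of \<open>P\<close> serves as a coefficient that makes a later one removable.\<close>

lemma bfs_path_height_ge:
  fixes P :: "'k::field mpoly set"
  assumes P: "primeideal P (poly_ring (n + 1))"
    and sub: "minors_ideal (n + 1) (bfs_path_edges h n) \<subseteq> P"
    and h: "2 \<le> h" "h \<le> 4" "h \<le> n \<or> h = 2" "1 \<le> n"
  shows "enat (n - 1) \<le> prime_height (poly_ring (n + 1)) P"
proof -
  interpret prime_poly_ideal "n + 1" P by (rule prime_poly_ideal.intro[OF P])
  have minors: "hankel_minor (bfs_parent h k) k \<in> P" if "2 \<le> k" "k \<le> n" for k
    using sub that minors_ideal_subset_iff[OF bfs_path_edges_less ideal]
    by (auto simp: bfs_path_edges_def)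
  \<comment> \<open>From vertex \<open>h\<close> on, the path runs through consecutive labels; for
    \<open>h = 2\<close> it does so from the root.\<close>
  have consecutive: "(\<forall>i \<in> {a<..n}. var i \<in> P) \<or> (\<forall>i \<in> {a..n + 1}. var i \<notin> P)"
    if "a = 1 \<and> h = 2 \<or> a = h" "1 \<le> a" for a
  proof (rule consecutive_minors[OF _ that(2) refl])
    fix i assume i: "a \<le> i" "i < n"
    then have "bfs_parent h (i + 1) = i" using that by (auto simp: bfs_parent_def)
    then show "hankel_minor i (i + 1) \<in> P"
      using minors[of "i + 1"] i that by auto
  qed
  have W: "enat (n - 1) \<le> prime_height (poly_ring (n + 1)) P"
    if "card W = n - 1" "W \<subseteq> {1..n + 1}" "\<And>v. v \<in> W \<Longrightarrow> removable v" for W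
    using height_ge_card[OF that(2,3)] that(1) by simp
  \<comment> \<open>If no variable from \<open>a\<close> on is in \<open>P\<close>, the minor of
    \<open>v - 2\<close> and \<open>v - 1\<close> makes \<open>var v\<close> removable, starting
    with \<open>v = a + 2\<close>.\<close>
  have tail: "removable v"
    if "a = 1 \<and> h = 2 \<or> a = h" "1 \<le> a" "a + 1 < v" "v \<le> n + 1" "\<forall>i \<in> {a..n + 1}. var i \<notin> P" for a v
  proof -
    have "bfs_parent h (v - 1) = v - 2" using that by (auto simp: bfs_parent_def)
    then have "hankel_minor (v - 2) (v - 1) \<in> P"
      using minors[of "v - 1"] that by auto
    then have "removable (Suc (v - 1))"
    proof (rule removable_minor)
      have "v - 2 \<in> {a..n + 1}" using that by auto
      then show "var (v - 2) \<notin> P" using that by blast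
    qed (use that in auto)
    then show ?thesis using that by simp
  qed
  consider "h = 2" | "h = 3" | "h = 4" using h by linarith
  then show ?thesis
  proof cases
    case 1
    from consecutive[of 1] consider "\<forall>i \<in> {1<..n}. var i \<in> P" | "\<forall>i \<in> {1..n + 1}. var i \<notin> P"
      using 1 by auto
    then show ?thesis
    proof cases
      case 1
      then show ?thesis by (intro W[of "{2..n}"] removable_var) auto
    next
      case 2
      then show ?thesis using \<open>h = 2\<close> by (intro W[of "{3..n + 1}"] tail[of 1]) auto
    qed
  next
    case 2
    then have n: "3 \<le> n" using h by auto
    have g12: "hankel_minor 1 2 \<in> P" and g13: "hankel_minor 1 3 \<in> P"
      using minors[of 2] minors[of 3] n 2 by (auto simp: bfs_parent_def)
    have m12: "var 1 \<in> P \<or> var 3 \<in> P \<longleftrightarrow> var 2 \<in> P"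
      using hankel_minor_mem[OF g12] n by (auto simp del: One_nat_def)
    have m13: "var 1 \<in> P \<or> var 4 \<in> P \<longleftrightarrow> var 3 \<in> P \<or> var 2 \<in> P"
      using hankel_minor_mem[OF g13] n by (auto simp del: One_nat_def)
    have r34: "removable 3" "removable 4" if "var 1 \<notin> P"
      using removable_minor[OF g12] removable_minor[OF g13] that by auto
    from consecutive[of 3] 2 consider (in_P) "\<forall>i \<in> {3<..n}. var i \<in> P" | (notin_P) "\<forall>i \<in> {3..n + 1}. var i \<notin> P"
      by auto
    then show ?thesis
    proof cases
      case in_P
      \<comment> \<open>If \<open>var 1\<close> is outside of \<open>P\<close>, then
        \<open>var 2\<close> and \<open>var 3\<close> are in \<open>P\<close> as soon as
        \<open>var 4\<close> is, which the tail ensures unless \<open>n = 3\<close>.\<close>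
      consider "var 1 \<in> P" "var 2 \<in> P" | "var 1 \<notin> P" "var 2 \<in> P" "var 3 \<in> P"
        | "var 1 \<notin> P" "n = 3"
        using m12 m13 in_P n by (cases "n = 3") auto
      then show ?thesis
      proof cases
        case 1
        then show ?thesis using in_P n
          by (intro W[of "insert 1 (insert 2 {4..n})"] removable_var) auto
      next
        case 2
        have "var v \<in> P" if "v \<in> {2..n}" for v
          using 2 in_P that by (cases "v = 2"; cases "v = 3") auto
        then show ?thesis by (intro W[of "{2..n}"] removable_var) auto
      next
        case 3
        then show ?thesis using r34 by (intro W[of "{3, 4}"]) auto
      qed
    next
      case notin_P
      have t: "removable v" if "5 \<le> v" "v \<le> n + 1" for v
        using tail[of 3 v] that notin_P \<open>h = 3\<close> by simp
      show ?thesis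
      proof (cases "var 1 \<in> P")
        case True
        then have "removable 1" "removable 2" using m12 removable_var by auto
        then show ?thesis using n t
          by (intro W[of "insert 1 (insert 2 {5..n + 1})"]) auto
      next
        case False
        have "removable v" if "v \<in> {3..n + 1}" for v
          using r34[OF False] t[of v] that by (cases "v = 3"; cases "v = 4") auto
        then show ?thesis by (intro W[of "{3..n + 1}"]) auto
      qed
    qed
  next
    case 3
    then have n: "4 \<le> n" using h by auto
    have g12: "hankel_minor 1 2 \<in> P" and g13: "hankel_minor 1 3 \<in> P" and g24: "hankel_minor 2 4 \<in> P"
      using minors[of 2] minors[of 3] minors[of 4] n 3 by (auto simp: bfs_parent_def)
    have m12: "var 1 \<in> P \<or> var 3 \<in> P \<longleftrightarrow> var 2 \<in> P"
      using hankel_minor_mem[OF g12] n by (auto simp del: One_nat_def)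
    have m13: "var 1 \<in> P \<or> var 4 \<in> P \<longleftrightarrow> var 3 \<in> P \<or> var 2 \<in> P"
      using hankel_minor_mem[OF g13] n by (auto simp del: One_nat_def)
    have m24: "var 2 \<in> P \<or> var 5 \<in> P \<longleftrightarrow> var 4 \<in> P \<or> var 3 \<in> P"
      using hankel_minor_mem[OF g24] n by (auto simp del: One_nat_def)
    have r34: "removable 3" "removable 4" if "var 1 \<notin> P"
      using removable_minor[OF g12] removable_minor[OF g13] that by auto
    have r5: "removable 5" if "var 2 \<notin> P"
      using removable_minor[OF g24] that by auto
    from consecutive[of 4] 3 consider (in_P) "\<forall>i \<in> {4<..n}. var i \<in> P" | (notin_P) "\<forall>i \<in> {4..n + 1}. var i \<notin> P"
      by auto
    then show ?thesis
    proof cases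
      case in_P
      \<comment> \<open>If \<open>var 1\<close> is in \<open>P\<close>, so is \<open>var 2\<close>,
        and the minor of 2 and 4 adds \<open>var 3\<close> or \<open>var 4\<close>. Otherwise
        \<open>var 2\<close>, \<open>var 3\<close>, \<open>var 4\<close> are in \<open>P\<close>
        together or not at all, and \<open>var 5\<close> forces them unless
        \<open>n = 4\<close>.\<close>
      consider "var 1 \<in> P" "var 2 \<in> P" "var 4 \<in> P" | "var 1 \<in> P" "var 2 \<in> P" "var 3 \<in> P"
        | "var 1 \<notin> P" "var 2 \<in> P" "var 3 \<in> P" "var 4 \<in> P"
        | "var 1 \<notin> P" "var 2 \<notin> P" "n = 4"
        using m12 m13 m24 in_P n by (cases "n = 4") auto
      then show ?thesis
      proof cases
        case 1
        have "var v \<in> P" if "v \<in> insert 1 (insert 2 {4..n})" for v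
          using 1 in_P that by (cases "v = 4") auto
        then show ?thesis using n
          by (intro W[of "insert 1 (insert 2 {4..n})"] removable_var) auto
      next
        case 2
        then show ?thesis using in_P n
          by (intro W[of "insert 1 (insert 2 (insert 3 {5..n}))"] removable_var) auto
      next
        case 3
        have "var v \<in> P" if "v \<in> {2..n}" for v
          using 3 in_P that by (cases "v = 2"; cases "v = 3"; cases "v = 4") auto
        then show ?thesis by (intro W[of "{2..n}"] removable_var) auto
      next
        case 4
        then show ?thesis using r34 r5 by (intro W[of "{3, 4, 5}"]) auto
      qed
    next
      case notin_P
      have t: "removable v" if "6 \<le> v" "v \<le> n + 1" for v
        using tail[of 4 v] that notin_P \<open>h = 4\<close> by simp
      have "var 4 \<notin> P" using notin_P n by auto
      show ?thesis
      proof (cases "var 1 \<in> P")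
        case True
        then have "removable 1" "removable 2" "removable 3"
          using m12 m24 \<open>var 4 \<notin> P\<close> removable_var by auto
        then show ?thesis using n t
          by (intro W[of "insert 1 (insert 2 (insert 3 {6..n + 1}))"]) auto
      next
        case False
        then have "var 2 \<notin> P" using m13 \<open>var 4 \<notin> P\<close> by auto
        have "removable v" if "v \<in> {3..n + 1}" for v
          using r34[OF False] r5[OF \<open>var 2 \<notin> P\<close>] t[of v] that
          by (cases "v = 3"; cases "v = 4"; cases "v = 5") auto
        then show ?thesis by (intro W[of "{3..n + 1}"]) auto
      qed
    qed
  qed
qed

section \<open>Upper bounds for the height from explicit parametrisations\<close>

lemma minors_ideal_subset_kernel:
  fixes q :: "nat \<Rightarrow> 'k::field mpoly"
  assumes "\<And>k. 2 \<le> k \<Longrightarrow> k \<le> n \<Longrightarrow>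
    q (bfs_parent h k) * q (k + 1) = q k * q (bfs_parent h k + 1)"
  shows "minors_ideal (n + 1) (bfs_path_edges h n) \<subseteq> subst_kernel (n + 1) q"
proof (subst minors_ideal_subset_iff[OF bfs_path_edges_less primeideal_poly_ringD(1)[OF primeideal_subst_kernel]])
  have "hankel_minor i j \<in> subst_kernel (n + 1) q" if "(i, j) \<in> bfs_path_edges h n" for i j
    using bfs_path_edges_less[OF that] hankel_minor_in_poly_ring[of i j "n + 1"] that assms
    by (auto simp: subst_kernel_def hankel_minor_def bfs_path_edges_def)
  then show "\<forall>(i, j) \<in> bfs_path_edges h n. hankel_minor i j \<in> subst_kernel (n + 1) q" by blast
qed

lemma ideal_height_le_kernel:
  fixes I :: "'k::field mpoly set"
  assumes "I \<subseteq> subst_kernel m q" "prime_height (poly_ring m) (subst_kernel m q) \<le> d"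
  shows "ideal_height (poly_ring m) I \<le> d"
  unfolding ideal_height_def
  by (rule Inf_lower2[OF _ assms(2)]) (use assms(1) primeideal_subst_kernel in blast)

lemma var_neq_0 [simp]: "var i \<noteq> (0 :: 'k::field mpoly)"
  by (metis lookup_single_eq lookup_zero var_def zero_neq_one)

text \<open>The ideal vanishes on the rational normal curve.\<close>

lemma bfs_path_height_le:
  assumes "1 \<le> n"
  shows "ideal_height (poly_ring (n + 1)) (minors_ideal (n + 1) (bfs_path_edges h n) :: 'k::field mpoly set)
    \<le> enat (n - 1)"
proof -
  \<comment> \<open>The variables \<open>var 1\<close> and \<open>var 2\<close> are reused as the
    two parameters of the affine cone over the curve.\<close>
  let ?q = "\<lambda>v. var 1 * var 2 ^ (v - 1) :: 'k mpoly"
  have "minors_ideal (n + 1) (bfs_path_edges h n) \<subseteq> subst_kernel (n + 1) ?q"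
  proof (rule minors_ideal_subset_kernel)
    fix k :: nat assume k: "2 \<le> k" "k \<le> n"
    have eq: "bfs_parent h k - 1 + k = k - 1 + bfs_parent h k"
      using k by (auto simp: bfs_parent_def)
    have "?q (bfs_parent h k) * ?q (k + 1) = var 1 ^ 2 * var 2 ^ (bfs_parent h k - 1 + k)"
      by (simp add: power_add power2_eq_square mult_ac)
    also have "\<dots> = ?q k * ?q (bfs_parent h k + 1)"
      unfolding eq by (simp add: power_add power2_eq_square mult_ac)
    finally show "?q (bfs_parent h k) * ?q (k + 1) = ?q k * ?q (bfs_parent h k + 1)" .
  qed
  \<comment> \<open>The order matters: killing \<open>var 1\<close> first would make all coordinates
    vanish at once.\<close>
  moreover have "prime_height (poly_ring (n + 1)) (subst_kernel (n + 1) ?q) \<le> enat (n + 1 - length [2, 1 :: nat])"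
    using assms by (intro prime_height_subst_kernel_le) (auto simp: less_Suc_eq)
  ultimately have "ideal_height (poly_ring (n + 1)) (minors_ideal (n + 1) (bfs_path_edges h n) :: 'k mpoly set)
      \<le> enat (n + 1 - length [2, 1 :: nat])"
    by (rule ideal_height_le_kernel)
  then show ?thesis by (simp add: numeral_2_eq_2)
qed

text \<open>The primes below contain \<open>x\<^sub>2, x\<^sub>3, x\<^sub>4\<close> and have a coordinate ring of dimension 3; this takes
  three shapes because the vertices 4 and 5 need not continue in the same way.\<close>

lemma bfs_path_height_le_of_ge_5:
  assumes "5 \<le> h" "h \<le> n"
  shows "ideal_height (poly_ring (n + 1)) (minors_ideal (n + 1) (bfs_path_edges h n) :: 'k::field mpoly set)
    \<le> enat (n - 2)"
proof -
  consider (five) "h = 5" | (six) "h = 6" | (large) "7 \<le> h" using assms by linarith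
  then show ?thesis
  proof cases
    case five
    \<comment> \<open>The tail starts at vertex 5: the coordinates from 5 on follow a rational
      normal curve with parameters \<open>var 5\<close> and \<open>var 6\<close>, and
      \<open>var 1\<close> is free.\<close>
    let ?q = "\<lambda>v. if v = 1 then var 1 else if 5 \<le> v then var 5 * var 6 ^ (v - 5) else 0 :: 'k mpoly"
    have "minors_ideal (n + 1) (bfs_path_edges h n) \<subseteq> subst_kernel (n + 1) ?q"
    proof (rule minors_ideal_subset_kernel)
      fix k :: nat assume k: "2 \<le> k" "k \<le> n"
      show "?q (bfs_parent h k) * ?q (k + 1) = ?q k * ?q (bfs_parent h k + 1)"
      proof (cases "5 < k")
        case True
        define j where "j = k - 6"
        have "k = j + 6" using True by (simp add: j_def)
        then show ?thesis using five by (simp add: bfs_parent_def mult_ac)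
      next
        case False
        then have "k = 2 \<or> k = 3 \<or> k = 4 \<or> k = 5" using k by auto
        then show ?thesis using five by (auto simp: bfs_parent_def)
      qed
    qed
    moreover have "prime_height (poly_ring (n + 1)) (subst_kernel (n + 1) ?q) \<le>
        enat (n + 1 - length [6, 5, 1 :: nat])"
      using assms by (intro prime_height_subst_kernel_le) (auto simp: less_Suc_eq)
    ultimately have "ideal_height (poly_ring (n + 1)) (minors_ideal (n + 1) (bfs_path_edges h n) :: 'k mpoly set)
        \<le> enat (n + 1 - length [6, 5, 1 :: nat])"
      by (rule ideal_height_le_kernel)
    then show ?thesis by (simp add: eval_nat_numeral)
  next
    case six
    \<comment> \<open>Vertex 6 is a child of 4 and starts the tail. The last variable,
      \<open>var (n + 1)\<close>, occurs only in the minor for \<open>k = n\<close>, multiplied by a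
      variable that is sent to 0.\<close>
    let ?q = "\<lambda>v. if v \<in> {1, 5, n + 1} then var v else 0 :: 'k mpoly"
    have "minors_ideal (n + 1) (bfs_path_edges h n) \<subseteq> subst_kernel (n + 1) ?q"
    proof (rule minors_ideal_subset_kernel)
      fix k :: nat assume k: "2 \<le> k" "k \<le> n"
      then consider "k = 2" | "k = 3" | "k = 4" | "k = 5" | "k = 6" | "6 < k" by linarith
      then show "?q (bfs_parent h k) * ?q (k + 1) = ?q k * ?q (bfs_parent h k + 1)"
        using six k assms by cases (auto simp: bfs_parent_def)
    qed
    moreover have "prime_height (poly_ring (n + 1)) (subst_kernel (n + 1) ?q) \<le>
        enat (n + 1 - length [n + 1, 5, 1 :: nat])"
      using assms by (intro prime_height_subst_kernel_le) (auto simp: less_Suc_eq)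
    ultimately have "ideal_height (poly_ring (n + 1)) (minors_ideal (n + 1) (bfs_path_edges h n) :: 'k mpoly set)
        \<le> enat (n + 1 - length [n + 1, 5, 1 :: nat])"
      by (rule ideal_height_le_kernel)
    then show ?thesis by (simp add: eval_nat_numeral)
  next
    case large
    \<comment> \<open>Vertices 6 and 7 are children of 4 and 5. No minor of an edge contains a
      product of two variables with indices in \<open>{1, 5, 7}\<close>, so these three are
      free.\<close>
    let ?q = "\<lambda>v. if v \<in> {1, 5, 7} then var v else 0 :: 'k mpoly"
    have "minors_ideal (n + 1) (bfs_path_edges h n) \<subseteq> subst_kernel (n + 1) ?q"
    proof (rule minors_ideal_subset_kernel)
      fix k :: nat assume k: "2 \<le> k" "k \<le> n"
      then consider "k = 2" | "k = 3" | "k = 4" | "k = 5" | "k = 6" | "k = 7" | "7 < k" by linarith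
      then show "?q (bfs_parent h k) * ?q (k + 1) = ?q k * ?q (bfs_parent h k + 1)"
        using large k assms by cases (auto simp: bfs_parent_def)
    qed
    moreover have "prime_height (poly_ring (n + 1)) (subst_kernel (n + 1) ?q) \<le>
        enat (n + 1 - length [7, 5, 1 :: nat])"
      using large assms by (intro prime_height_subst_kernel_le) (auto simp: less_Suc_eq)
    ultimately have "ideal_height (poly_ring (n + 1)) (minors_ideal (n + 1) (bfs_path_edges h n) :: 'k mpoly set)
        \<le> enat (n + 1 - length [7, 5, 1 :: nat])"
      by (rule ideal_height_le_kernel)
    then show ?thesis by (simp add: eval_nat_numeral)
  qed
qed

theorem bfs_path_complete_intersection_iff:
  assumes "1 \<le> n" "2 \<le> h" "h \<le> n \<or> h = 2"
  shows "complete_intersection (n + 1)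
      (minors_ideal (n + 1) (bfs_path_edges h n) :: 'k::field mpoly set) \<longleftrightarrow> h \<le> 4"
proof -
  let ?I = "minors_ideal (n + 1) (bfs_path_edges h n) :: 'k mpoly set"
  have "enat (n - 1) = ideal_height (poly_ring (n + 1)) ?I \<longleftrightarrow> h \<le> 4"
  proof (cases "h \<le> 4")
    case True
    have "enat (n - 1) \<le> ideal_height (poly_ring (n + 1)) ?I"
      unfolding ideal_height_def
      by (rule Inf_greatest) (use bfs_path_height_ge[OF _ _ assms(2) True assms(3,1)] in auto)
    then show ?thesis using bfs_path_height_le[OF assms(1)] True antisym by blast
  next
    case False
    then have h: "5 \<le> h" "h \<le> n" using assms(3) by auto
    have "enat (n - 2) < enat (n - 1)" using h by simp
    then show ?thesis using bfs_path_height_le_of_ge_5[OF h, where 'k = 'k] False by (metis leD)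
  qed
  then show ?thesis
    unfolding complete_intersection_def num_generators_bfs_path .
qed


section \<open>Breadth-first labellings of paths\<close>

text \<open>Vertices are processed in the order of their labels, so parents are monotone. The clause
  \<open>par k < i\<close> carries this through a step, in which all new vertices receive the parent
  \<open>i\<close>. Positions count from 0 here.\<close>

lemma bfs_parents:
  assumes "bfs G i ws"
  shows "distinct ws \<and> i \<le> length ws \<and> (\<exists>par.
    (\<forall>k. 1 \<le> k \<and> k < length ws \<longrightarrow> par k < i \<and> par k < k \<and> (ws ! par k, ws ! k) \<in> parcs G) \<and>
    (\<forall>j k. 1 \<le> j \<and> j \<le> k \<and> k < length ws \<longrightarrow> par j \<le> par k))"
  using assms
proof induction
  case (root r)
  then show ?case by simp
next
  case (step i vs ws)
  then obtain par where vs: "distinct vs" "i \<le> length vs"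
    and par: "\<And>k. 1 \<le> k \<Longrightarrow> k < length vs \<Longrightarrow> par k < i \<and> par k < k \<and> (vs ! par k, vs ! k) \<in> parcs G"
    and mono: "\<And>j k. 1 \<le> j \<Longrightarrow> j \<le> k \<Longrightarrow> k < length vs \<Longrightarrow> par j \<le> par k" by blast
  define par' where "par' k = (if k < length vs then par k else i)" for k
  have "distinct (vs @ ws)" using vs(1) step.hyps by auto
  moreover have "Suc i \<le> length (vs @ ws)" using step.hyps by simp
  moreover have "par' k < Suc i \<and> par' k < k \<and> ((vs @ ws) ! par' k, (vs @ ws) ! k) \<in> parcs G"
    if k: "1 \<le> k" "k < length (vs @ ws)" for k
  proof (cases "k < length vs")
    case True
    then show ?thesis using par[of k] k by (auto simp: par'_def nth_append)
  next
    case False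
    then have "ws ! (k - length vs) \<in> set ws" using k by auto
    then have "(vs ! i, ws ! (k - length vs)) \<in> parcs G" using step.hyps by auto
    then show ?thesis using False step.hyps by (auto simp: par'_def nth_append)
  qed
  moreover have "par' j \<le> par' k" if "1 \<le> j" "j \<le> k" "k < length (vs @ ws)" for j k
    using that mono[of j k] par[of j] by (auto simp: par'_def)
  ultimately show ?case by blast
qed

text \<open>Siblings have consecutive labels by monotonicity. Thus \<open>two\<close> limits every
  vertex but the root to one child and \<open>three\<close> limits the root to two. From label 3 on,
  the gap \<open>k - p k\<close> is then 1 or 2, and once it is 1 it stays 1.\<close>

lemma bfs_parent_unique:
  fixes p :: "nat \<Rightarrow> nat"
  assumes range: "\<And>k. 2 \<le> k \<Longrightarrow> k \<le> n \<Longrightarrow> 1 \<le> p k \<and> p k < k"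
    and mono: "\<And>j k. 2 \<le> j \<Longrightarrow> j \<le> k \<Longrightarrow> k \<le> n \<Longrightarrow> p j \<le> p k"
    and two: "\<And>k. 2 \<le> k \<Longrightarrow> k + 1 \<le> n \<Longrightarrow> p k = p (k + 1) \<Longrightarrow> p k = 1"
    and three: "\<And>k. 2 \<le> k \<Longrightarrow> k + 2 \<le> n \<Longrightarrow> p k = p (k + 1) \<Longrightarrow> p (k + 1) \<noteq> p (k + 2)"
  obtains h where "2 \<le> h" "h \<le> n \<or> h = 2" "\<And>k. 2 \<le> k \<Longrightarrow> k \<le> n \<Longrightarrow> p k = bfs_parent h k"
proof -
  \<comment> \<open>From label 3 on, \<open>p\<close> increases strictly: equal values at
    \<open>k\<close> and \<open>k + 1\<close> would give the root the three children 2, 3 and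
    4.\<close>
  have ge: "k - 2 \<le> p k" if "3 \<le> k" "k \<le> n" for k
    using that
  proof (induction k rule: dec_induct)
    case base
    then show ?case using range[of 3] by simp
  next
    case (step k)
    have "p k \<noteq> p (k + 1)"
    proof
      assume eq: "p k = p (k + 1)"
      then have "p k = 1" using two[of k] step by simp
      then have "k = 3" using step by simp
      moreover have "p 2 = 1" using range[of 2] step by auto
      ultimately show False using three[of 2] eq \<open>p k = 1\<close> step by (simp add: eval_nat_numeral)
    qed
    then show ?case using mono[of k "k + 1"] step by simp
  qed
  have up: "p (k + 1) = k" if "3 \<le> k" "k + 1 \<le> n" "p k = k - 1" for k
    using two[of k] mono[of k "k + 1"] range[of "k + 1"] that by (cases "p k = p (k + 1)") auto
  have near: "p k = k - 1 \<or> p k = k - 2" if "3 \<le> k" "k \<le> n" for k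
    using ge[of k] range[of k] that by linarith
  \<comment> \<open>The element 2 is the default for a path on which no label \<open>k\<close> has
    the parent \<open>k - 2\<close>.\<close>
  define H where "H = insert 2 {k \<in> {3..n}. p k = k - 2}"
  define h where "h = Max H"
  have fin: "finite H" by (simp add: H_def)
  have h: "h \<in> H" unfolding h_def by (rule Max_in[OF fin]) (simp add: H_def)
  have max: "k \<le> h" if "k \<in> H" for k using Max_ge[OF fin that] by (simp add: h_def)
  have "p k = bfs_parent h k" if k: "2 \<le> k" "k \<le> n" for k
  proof -
    consider "k = 2" | "3 \<le> k" "h < k" | "3 \<le> k" "k \<le> h" using k by linarith
    then show ?thesis
    proof cases
      case 1
      then show ?thesis using range[of 2] k by (auto simp: bfs_parent_def)
    next
      case 2
      then have "k \<notin> H" using max[of k] by auto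
      then show ?thesis using near[of k] 2 k by (auto simp: H_def bfs_parent_def)
    next
      case 3
      have hn: "h \<le> n" "p h = h - 2" using h 3 by (auto simp: H_def)
      have "p k \<noteq> k - 1"
      proof
        assume pk: "p k = k - 1"
        have "p j = j - 1" if "k \<le> j" "j \<le> h" for j
          using that
        proof (induction j rule: dec_induct)
          case (step j)
          then show ?case using up[of j] 3 hn by simp
        qed (rule pk)
        from this[of h] show False using hn 3 by simp
      qed
      then show ?thesis using near[of k] 3 k by (auto simp: bfs_parent_def)
    qed
  qed
  moreover have "2 \<le> h" "h \<le> n \<or> h = 2" using h by (auto simp: H_def)
  ultimately show ?thesis using that by blast
qed

text \<open>For \<open>5 \<le> h\<close> the neighbours 2 and 3 of the root have the children 4 and
  5. For \<open>h\<close> equal to 2, 3 or 4, the vertex 1, 2 or 3, respectively, is a leaf.\<close>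

lemma bfs_path_leaf_near_root_iff:
  fixes n h :: nat
  defines "N \<equiv> \<lambda>i. {j. (i, j) \<in> bfs_path_edges h n \<or> (j, i) \<in> bfs_path_edges h n}"
  assumes "2 \<le> h" "h \<le> n \<or> h = 2"
  shows "card (N 1) \<le> 1 \<or> (\<exists>i. card (N i) \<le> 1 \<and> i \<in> N 1) \<longleftrightarrow> h \<le> 4"
proof
  have finN: "finite (N i)" for i
  proof (rule finite_subset)
    show "N i \<subseteq> {0..n}" by (auto simp: N_def dest: bfs_path_edges_less)
  qed simp
  have edge: "k \<in> N (bfs_parent h k)" "bfs_parent h k \<in> N k" if "2 \<le> k" "k \<le> n" for k
    using that by (auto simp: N_def bfs_path_edges_def)
  have two: "\<not> card (N i) \<le> 1" if "a \<in> N i" "b \<in> N i" "a \<noteq> b" for a b i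
    using card_mono[OF finN, of "{a, b}" i] that by auto
  show "h \<le> 4" if L: "card (N 1) \<le> 1 \<or> (\<exists>i. card (N i) \<le> 1 \<and> i \<in> N 1)"
  proof (rule ccontr)
    assume "\<not> h \<le> 4"
    then have h: "5 \<le> h" "5 \<le> n" using assms by auto
    have e: "2 \<in> N 1" "1 \<in> N 2" "3 \<in> N 1" "1 \<in> N 3" "4 \<in> N 2" "5 \<in> N 3"
      using edge[of 2] edge[of 3] edge[of 4] edge[of 5] h by (simp_all add: bfs_parent_def)
    have "i = 2 \<or> i = 3" if "i \<in> N 1" for i
      using that h by (auto simp: N_def bfs_path_edges_def bfs_parent_def split: if_splits)
    then show False using L two[of 2 1 3] two[of 1 2 4] two[of 1 3 5] e by auto
  qed
  show "card (N 1) \<le> 1 \<or> (\<exists>i. card (N i) \<le> 1 \<and> i \<in> N 1)" if "h \<le> 4"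
  proof -
    have one: "card (N i) \<le> 1" if "N i \<subseteq> {a}" for i a
      using card_mono[OF _ that] by simp
    consider "h = 2" | "h = 3" | "h = 4" using \<open>h \<le> 4\<close> assms(2) by linarith
    then show ?thesis
    proof cases
      case 1
      then have "N 1 \<subseteq> {2}"
        by (auto simp: N_def bfs_path_edges_def bfs_parent_def split: if_splits)
      then show ?thesis using one by blast
    next
      case 2
      then have "N 2 \<subseteq> {1}"
        by (auto simp: N_def bfs_path_edges_def bfs_parent_def split: if_splits)
      moreover have "2 \<in> N 1" using edge[of 2] 2 assms(3) by (simp add: bfs_parent_def)
      ultimately show ?thesis using one by blast
    next
      case 3
      then have "N 3 \<subseteq> {1}"
        by (auto simp: N_def bfs_path_edges_def bfs_parent_def split: if_splits)
      moreover have "3 \<in> N 1" using edge[of 3] 3 assms(3) by (simp add: bfs_parent_def)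
      ultimately show ?thesis using one by blast
    qed
  qed
qed

section \<open>Edges of a path and breadth-first parents\<close>

lemma path_graph_neighbours:
  assumes "path_graph T"
  shows "finite {w. (v, w) \<in> parcs T}" "card {w. (v, w) \<in> parcs T} \<le> 2"
proof -
  obtain vs where vs: "distinct vs"
    "parcs T = {(u, v). \<exists>i. Suc i < length vs \<and> {u, v} = {vs ! i, vs ! Suc i}}"
    using assms by (auto simp: path_graph_def)
  have "\<exists>a b. {w. (v, w) \<in> parcs T} \<subseteq> {a, b}"
  proof (cases "v \<in> set vs")
    case True
    then obtain p where p: "p < length vs" "v = vs ! p" by (auto simp: in_set_conv_nth)
    \<comment> \<open>At the ends of the path, the truncated \<open>p - 1\<close> or an out-of-range
      \<open>Suc p\<close> only enlarges the right-hand side, which is harmless for an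
      inclusion.\<close>
    have "w \<in> {vs ! (p - 1), vs ! Suc p}" if "(v, w) \<in> parcs T" for w
    proof -
      obtain i where i: "Suc i < length vs" "{v, w} = {vs ! i, vs ! Suc i}"
        using \<open>(v, w) \<in> parcs T\<close> vs(2) by auto
      then consider "v = vs ! i" "w = vs ! Suc i" | "v = vs ! Suc i" "w = vs ! i"
        by (auto simp: doubleton_eq_iff)
      then show ?thesis
      proof cases
        case 1
        then have "i = p" using vs(1) p i nth_eq_iff_index_eq by (metis Suc_lessD)
        then show ?thesis using 1 by simp
      next
        case 2
        then have "Suc i = p" using vs(1) p i nth_eq_iff_index_eq by metis
        then show ?thesis using 2 by auto
      qed
    qed
    then show ?thesis by blast
  next
    case False
    have "(v, w) \<notin> parcs T" for w
    proof
      assume "(v, w) \<in> parcs T"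
      then obtain i where i: "Suc i < length vs" "{v, w} = {vs ! i, vs ! Suc i}" using vs(2) by auto
      then have "v = vs ! i \<or> v = vs ! Suc i" by (auto simp: doubleton_eq_iff)
      then show False using False i(1) by (metis Suc_lessD nth_mem)
    qed
    then show ?thesis by auto
  qed
  then obtain a b where ab: "{w. (v, w) \<in> parcs T} \<subseteq> {a, b}" by blast
  then show "finite {w. (v, w) \<in> parcs T}" by (rule finite_subset) simp
  have "card {w. (v, w) \<in> parcs T} \<le> card {a, b}" using ab by (rule card_mono[rotated]) simp
  also have "\<dots> \<le> 2" by (simp add: card_insert_if)
  finally show "card {w. (v, w) \<in> parcs T} \<le> 2" .
qed

lemma leaf_iff_card: "leaf G v \<longleftrightarrow> v \<in> pverts G \<and> card {w. (v, w) \<in> parcs G} \<le> 1"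
proof -
  have "out_arcs (with_proj G) v = Pair v ` {w. (v, w) \<in> parcs G}"
    by (auto simp: out_arcs_def)
  then have "out_degree (with_proj G) v = card {w. (v, w) \<in> parcs G}"
    unfolding out_degree_def by (simp add: card_image inj_on_def)
  then show ?thesis by (simp add: leaf_def)
qed

text \<open>Since a path has only \<open>n - 1\<close> edges, all of them are edges from a vertex to its breadth-first
  parent.\<close>

lemma path_graph_arcs_eq:
  assumes T: "path_graph T" "card (pverts T) = n" and V: "inj_on V {1..n}" "V ` {1..n} = pverts T"
    and p: "\<And>k. 2 \<le> k \<Longrightarrow> k \<le> n \<Longrightarrow> 1 \<le> p k \<and> p k < k \<and> (V (p k), V k) \<in> parcs T"
  shows "{(i, j). 1 \<le> i \<and> i < j \<and> j \<le> n \<and> (V i, V j) \<in> parcs T} = (\<lambda>k. (p k, k)) ` {2..n}"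
    (is "?D = ?E")
proof -
  obtain vs where vs: "distinct vs" "set vs = pverts T"
    "parcs T = {(u, v). \<exists>i. Suc i < length vs \<and> {u, v} = {vs ! i, vs ! Suc i}}"
    using T by (auto simp: path_graph_def)
  have len: "length vs = n" using vs(1,2) T(2) distinct_card by metis
  have fin: "finite ?D" by (rule finite_subset[of _ "{0..n} \<times> {0..n}"]) auto
  let ?e = "\<lambda>(i, j). {V i, V j}"
  have inj: "inj_on ?e ?D"
  proof (rule inj_onI)
    fix x y assume "x \<in> ?D" "y \<in> ?D" "?e x = ?e y"
    then obtain i j a b where xy: "x = (i, j)" "y = (a, b)"
      and *: "1 \<le> i" "i < j" "j \<le> n" "1 \<le> a" "a < b" "b \<le> n" "{V i, V j} = {V a, V b}"
      by auto
    have "{i, j} = {a, b}"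
      using inj_on_image_eq_iff[OF V(1), of "{i, j}" "{a, b}"] * by simp
    then show "x = y" using * xy by (auto simp: doubleton_eq_iff)
  qed
  have "?e ` ?D \<subseteq> (\<lambda>i. {vs ! i, vs ! Suc i}) ` {..<n - 1}"
  proof
    fix S assume "S \<in> ?e ` ?D"
    then obtain i j where S: "S = {V i, V j}" and "(V i, V j) \<in> parcs T" by auto
    then obtain k where "Suc k < n" "{V i, V j} = {vs ! k, vs ! Suc k}" using vs(3) len by auto
    then show "S \<in> (\<lambda>i. {vs ! i, vs ! Suc i}) ` {..<n - 1}"
      unfolding S by (intro image_eqI[of _ _ k]) auto
  qed
  then have "card (?e ` ?D) \<le> card ((\<lambda>i. {vs ! i, vs ! Suc i}) ` {..<n - 1})"
    by (intro card_mono) auto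
  also have "\<dots> \<le> n - 1" using card_image_le[of "{..<n - 1}"] by auto
  finally have "card ?D \<le> n - 1" by (simp only: card_image[OF inj])
  also have "\<dots> = card ?E"
    by (subst card_image) (auto simp: inj_on_def)
  finally have "card ?D \<le> card ?E" .
  moreover have "?E \<subseteq> ?D" using p by auto
  ultimately show ?thesis using card_seteq[OF fin] by blast
qed

lemma rooted_labeling_path:
  assumes T: "path_graph T" "card (pverts T) = n" and l: "rooted_labeling T l"
  shows "\<exists>V h. 2 \<le> h \<and> (h \<le> n \<or> h = 2) \<and> V ` {1..n} = pverts T \<and> (\<forall>i \<in> {1..n}. l (V i) = i) \<and>
    {(i, j). 1 \<le> i \<and> i < j \<and> j \<le> n \<and> (V i, V j) \<in> parcs T} = bfs_path_edges h n"
proof -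
  obtain ws where ws: "bfs T (length ws) ws" "set ws = pverts T" "\<And>k. k < length ws \<Longrightarrow> l (ws ! k) = k + 1"
    using l by (auto simp: rooted_labeling_def)
  obtain par where dist: "distinct ws"
    and par: "\<And>k. 1 \<le> k \<Longrightarrow> k < length ws \<Longrightarrow> par k < k \<and> (ws ! par k, ws ! k) \<in> parcs T"
    and mono: "\<And>j k. 1 \<le> j \<Longrightarrow> j \<le> k \<Longrightarrow> k < length ws \<Longrightarrow> par j \<le> par k"
    using bfs_parents[OF ws(1)] by blast
  have len: "length ws = n" using dist ws(2) T(2) distinct_card by metis
  \<comment> \<open>\<open>V\<close> inverts \<open>l\<close> on the labels; here positions counted
    from 0 are shifted to labels counted from 1.\<close>
  define V where "V i = ws ! (i - 1)" for i
  define p where "p k = Suc (par (k - 1))" for k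
  have lV: "l (V i) = i" if "i \<in> {1..n}" for i
    using ws(3)[of "i - 1"] that len by (auto simp: V_def)
  then have inj: "inj_on V {1..n}" by (metis inj_onI)
  have img: "V ` {1..n} = pverts T"
  proof -
    have "V ` {1..n} = (!) ws ` {..<n}"
      by (force simp: V_def image_iff intro: bexI[of _ "Suc _"])
    then show ?thesis using ws(2) len by (auto simp: set_conv_nth)
  qed
  have p: "1 \<le> p k \<and> p k < k \<and> (V (p k), V k) \<in> parcs T" if "2 \<le> k" "k \<le> n" for k
  proof -
    have "par (k - 1) < k - 1" "(ws ! par (k - 1), ws ! (k - 1)) \<in> parcs T"
      using par[of "k - 1"] that len by auto
    then show ?thesis by (simp add: p_def V_def less_diff_conv)
  qed
  have sym: "(v, u) \<in> parcs T" if "(u, v) \<in> parcs T" for u v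
    using that T(1) by (auto simp: path_graph_def insert_commute)
  have no_three: False
    if "(v, V a) \<in> parcs T" "(v, V b) \<in> parcs T" "(v, V c) \<in> parcs T"
      "a \<in> {1..n}" "b \<in> {1..n}" "c \<in> {1..n}" "a < b" "b < c" for v a b c
  proof -
    have "card (V ` {a, b, c}) = card {a, b, c}"
      using that by (intro card_image inj_on_subset[OF inj]) auto
    then have "card {V a, V b, V c} = 3" using that(7,8) by simp
    moreover have "card {V a, V b, V c} \<le> card {w. (v, w) \<in> parcs T}"
      using that path_graph_neighbours(1)[OF T(1)] by (intro card_mono) auto
    ultimately show False using path_graph_neighbours(2)[OF T(1), of v] by simp
  qed
  obtain h where h: "2 \<le> h" "h \<le> n \<or> h = 2" "\<And>k. 2 \<le> k \<Longrightarrow> k \<le> n \<Longrightarrow> p k = bfs_parent h k"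
  proof (rule bfs_parent_unique[of n p])
    show "1 \<le> p k \<and> p k < k" if "2 \<le> k" "k \<le> n" for k using p that by blast
    show "p j \<le> p k" if "2 \<le> j" "j \<le> k" "k \<le> n" for j k
      using mono[of "j - 1" "k - 1"] that len by (auto simp: p_def)
    \<comment> \<open>Otherwise the vertex labelled \<open>p k\<close> would have three neighbours:
      its own parent and the children \<open>k\<close> and \<open>k + 1\<close>.\<close>
    show "p k = 1" if k: "2 \<le> k" "k + 1 \<le> n" "p k = p (k + 1)" for k
    proof (rule ccontr)
      assume "p k \<noteq> 1"
      then have "2 \<le> p k" "p k < k" using p[of k] k by auto
      then show False
        using no_three[of "V (p k)" "p (p k)" k "k + 1"] p[of k] p[of "k + 1"] p[of "p k"] k sym by auto
    qed
    show "p (k + 1) \<noteq> p (k + 2)" if k: "2 \<le> k" "k + 2 \<le> n" "p k = p (k + 1)" for k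
      using no_three[of "V (p k)" k "k + 1" "k + 2"] p[of k] p[of "k + 1"] p[of "k + 2"] k by auto
  qed blast
  have "{(i, j). 1 \<le> i \<and> i < j \<and> j \<le> n \<and> (V i, V j) \<in> parcs T} = bfs_path_edges h n"
    using path_graph_arcs_eq[OF T inj img p] h(3) by (simp add: bfs_path_edges_def)
  then show ?thesis using h(1,2) img lV by blast
qed

theorem theorem3p2:
  fixes T :: "'v pair_pre_digraph" and l :: "'v \<Rightarrow> nat" and n :: nat and root :: 'v
  assumes "path_graph T" and "card (pverts T) = n"
    and "rooted_labeling T l"
    and "root \<in> pverts T" and "l root = 1"
  shows "complete_intersection (n + 1)
           (hankel_edge_ideal n (relabel l T) :: 'k::field mpoly set) \<longleftrightarrow>
         (leaf T root \<or> (\<exists>v. leaf T v \<and> (v, root) \<in> parcs T))"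
proof -
  obtain V h where h: "2 \<le> h" "h \<le> n \<or> h = 2" and V: "V ` {1..n} = pverts T"
    and lV: "\<And>i. i \<in> {1..n} \<Longrightarrow> l (V i) = i"
    and E: "{(i, j). 1 \<le> i \<and> i < j \<and> j \<le> n \<and> (V i, V j) \<in> parcs T} = bfs_path_edges h n"
    using rooted_labeling_path[OF assms(1-3)] by blast
  define N where "N i = {j. (i, j) \<in> bfs_path_edges h n \<or> (j, i) \<in> bfs_path_edges h n}" for i
  have sym: "(u, v) \<in> parcs T \<longleftrightarrow> (v, u) \<in> parcs T" for u v
    using assms(1) by (auto simp: path_graph_def insert_commute)
  have graph: "pair_graph T" using assms(1) by (simp add: path_graph_def)
  then interpret pair_graph T .
  have verts: "u \<in> pverts T" "v \<in> pverts T" "u \<noteq> v" if "(u, v) \<in> parcs T" for u v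
    using in_arcsD1[OF that] in_arcsD2[OF that] no_loops[OF that] by auto
  have arcs: "(V i, V j) \<in> parcs T \<longleftrightarrow> j \<in> N i" if "i \<in> {1..n}" "j \<in> {1..n}" for i j
  proof -
    consider "i < j" | "j < i" | "i = j" by linarith
    then show ?thesis
      using that verts(3)[of "V i" "V j"] sym[of "V i" "V j"] unfolding N_def E[symmetric]
      by cases auto
  qed
  have nonempty: "1 \<le> n" using assms(2,4) by (metis One_nat_def Suc_leI card_gt_0_iff empty_iff finite_verts)
  have inj: "inj_on V {1..n}" using lV by (metis inj_onI)
  have root: "root = V 1"
  proof -
    obtain i where "i \<in> {1..n}" "root = V i" using assms(4) V by blast
    then show ?thesis using lV[of i] assms(5) by simp
  qed
  \<comment> \<open>Each edge is present as two arcs; \<open>i < j\<close> selects the one from the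
    breadth-first parent to the child.\<close>
  have edges: "{(i, j). i < j \<and> (i, j) \<in> parcs (relabel l T)} = bfs_path_edges h n"
  proof -
    have "(i, j) \<in> parcs (relabel l T) \<longleftrightarrow> i \<in> {1..n} \<and> j \<in> {1..n} \<and> (V i, V j) \<in> parcs T" for i j
    proof
      assume "(i, j) \<in> parcs (relabel l T)"
      then obtain u v where uv: "(u, v) \<in> parcs T" "i = l u" "j = l v" by (auto simp: relabel_def)
      moreover obtain a b where "a \<in> {1..n}" "b \<in> {1..n}" "u = V a" "v = V b"
        using verts[OF uv(1)] V by blast
      ultimately show "i \<in> {1..n} \<and> j \<in> {1..n} \<and> (V i, V j) \<in> parcs T" using lV by simp
    next
      assume "i \<in> {1..n} \<and> j \<in> {1..n} \<and> (V i, V j) \<in> parcs T"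
      then show "(i, j) \<in> parcs (relabel l T)"
        using lV by (auto simp: relabel_def image_iff intro!: bexI[of _ "(V i, V j)"])
    qed
    then show ?thesis unfolding E[symmetric] by auto
  qed
  have "{hankel_minor i j | i j. i < j \<and> (i, j) \<in> parcs (relabel l T)} =
      (\<lambda>(i, j). hankel_minor i j :: 'k mpoly) ` bfs_path_edges h n"
    unfolding edges[symmetric] by auto
  then have ideal: "(hankel_edge_ideal n (relabel l T) :: 'k mpoly set) =
      minors_ideal (n + 1) (bfs_path_edges h n)"
    by (simp add: hankel_edge_ideal_def minors_ideal_def)
  have leaf: "leaf T (V i) \<longleftrightarrow> card (N i) \<le> 1" if i: "i \<in> {1..n}" for i
  proof -
    have Nn: "N i \<subseteq> {1..n}" by (auto simp: N_def dest: bfs_path_edges_less)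
    have "{w. (V i, w) \<in> parcs T} = V ` N i"
    proof (intro equalityI subsetI)
      fix w assume w: "w \<in> {w. (V i, w) \<in> parcs T}"
      then obtain j where "j \<in> {1..n}" "w = V j" using verts V by blast
      then show "w \<in> V ` N i" using w arcs i by auto
    qed (use arcs i Nn in auto)
    then show ?thesis
      using leaf_iff_card[of T "V i"] card_image[OF inj_on_subset[OF inj Nn]] V i by auto
  qed
  have one: "1 \<in> {1..n}" using nonempty by simp
  have "(\<exists>v. leaf T v \<and> (v, root) \<in> parcs T) \<longleftrightarrow> (\<exists>i. card (N i) \<le> 1 \<and> i \<in> N 1)"
  proof
    assume "\<exists>v. leaf T v \<and> (v, root) \<in> parcs T"
    then obtain v where v: "leaf T v" "(v, root) \<in> parcs T" by blast
    then obtain i where i: "i \<in> {1..n}" "v = V i" using verts(1) V by blast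
    then show "\<exists>i. card (N i) \<le> 1 \<and> i \<in> N 1"
      using v leaf[OF i(1)] arcs[OF one i(1)] sym root by auto
  next
    assume "\<exists>i. card (N i) \<le> 1 \<and> i \<in> N 1"
    then obtain i where i: "card (N i) \<le> 1" "i \<in> N 1" by blast
    then have "i \<in> {1..n}" by (auto simp: N_def dest: bfs_path_edges_less)
    then show "\<exists>v. leaf T v \<and> (v, root) \<in> parcs T"
      using i leaf arcs[OF one] sym root by (intro exI[of _ "V i"]) auto
  qed
  then have "leaf T root \<or> (\<exists>v. leaf T v \<and> (v, root) \<in> parcs T) \<longleftrightarrow> h \<le> 4"
    using bfs_path_leaf_near_root_iff[OF h] leaf[OF one] root by (simp add: N_def)
  then show ?thesis
    unfolding ideal using bfs_path_complete_intersection_iff[OF nonempty h] by blast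
qed

end
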